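(* Let $n\ge 1$ and let $\delta\colon\{1,\dots,n\}\to\{0,1\}$ be any increment function of size $n$. The alt-Tamari poset $\operatorname{Tam}^\delta_n$ contains: \begin{itemize} \item $\displaystyle \frac{1}{n+1}\binom{2n}{n}$ linear intervals of height $0$, \item $\displaystyle \binom{2n-1}{n-2}$ linear intervals of height $1$, \item $\displaystyle 2\binom{2n-k}{n-k-1}$ linear intervals of height $k$, for $2\le k<n$. \end{itemize} Furthermore, there are no linear intervals of height $k\ge n$.
   Context: Binomial coefficients $\binom{a}{b}$ with $b<0$ or $b>a$ are $0$. Intervals. In a finite poset, for $P\le Q$ the interval $[P,Q]$ is the set of $R$ with $P\le R\le Q$. Its height is the maximal length $k$ of a chain $P=P_0<P_1<\dots<P_k=Q$. It is linear if it is totally ordered. Dyck paths. A Dyck path of size (or length) $n$ is a word with $n$ letters $u$ (up steps) and $n$ letters $d$ (down steps) such that every prefix contains at least as many $u$ as $d$. Its up steps are numbered $u_1,\dots,u_n$ from left to right. A subword is a portion of consecutive letters. A valley is a down step immediately followed by an up step. Alt-Tamari posets. An increment function of size $n$ is a function $\delta\colon\{1,\dots,n\}\to\{0,1\}$. Put $\delta(u_i)=\delta(i)$, $\delta(d)=-1$, and $\delta(A)=\sum_{s\in A}\delta(s)$ for a subword $A$ of a Dyck path $P$ of size $n$. The $\delta$-excursion of $u_i$ in $P$ is the smallest (nonempty) subword $C_i$ of $P$ starting with $u_i$ such that $\delta(C_i)=0$ (it always exists). If $P$ has a valley $du_i$, the $\delta$-rotation of $P$ at $u_i$ is the Dyck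 path $Q$ obtained by exchanging the down step preceding $u_i$ with the $\delta$-excursion $C_i$ of $u_i$: $P=A\,d\,C_i\,B$ and $Q=A\,C_i\,d\,B$. The alt-Tamari poset $\operatorname{Tam}^\delta_n$ is the set of Dyck paths of size $n$ with the order given by the reflexive transitive closure of the relation "$Q$ is a $\delta$-rotation of $P$" (with $P$ below $Q$); this is a partial order. *)

theory Defs
  imports Complex_Main "HOL-Library.FuncSet"
begin

text \<open>Nonnegativity of the lower index is tested explicitly: with truncated subtraction on
  \<^typ>\<open>nat\<close>, the coefficient with lower index \<open>n - 2\<close> would be \<open>1\<close>, not \<open>0\<close>, at \<open>n = 1\<close>.\<close>

definition binom :: "int \<Rightarrow> int \<Rightarrow> nat" where
  "binom a b = (if b < 0 \<or> b > a then 0 else nat a choose nat b)"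

text \<open>A poset is given by its order relation \<open>r\<close>, a set of pairs contained in
  \<open>X \<times> X\<close> for the carrier \<open>X\<close>.\<close>

definition interval :: "('a \<times> 'a) set \<Rightarrow> 'a \<Rightarrow> 'a \<Rightarrow> 'a set" where
  "interval r P Q = {R. (P, R) \<in> r \<and> (R, Q) \<in> r}"

text \<open>\<open>(P, Q) \<in> (r - Id) ^^ k\<close> says that there is a chain
  \<open>P = P\<^sub>0 < P\<^sub>1 < \<dots> < P\<^sub>k = Q\<close>.\<close>

definition height :: "('a \<times> 'a) set \<Rightarrow> 'a \<Rightarrow> 'a \<Rightarrow> nat" where
  "height r P Q = (GREATEST k. (P, Q) \<in> (r - Id) ^^ k)"

definition linear_intervals :: "('a \<times> 'a) set \<Rightarrow> nat \<Rightarrow> 'a set set" where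
  "linear_intervals r k =
     {interval r P Q | P Q. (P, Q) \<in> r \<and> total_on (interval r P Q) r \<and> height r P Q = k}"

datatype step = U | D

definition dyck_paths :: "nat \<Rightarrow> step list set" where
  "dyck_paths n =
     {P. count_list P U = n \<and> count_list P D = n \<and>
         (\<forall>m\<le>length P. count_list (take m P) D \<le> count_list (take m P) U)}"

text \<open>The up step at (0-based) position \<open>j\<close> of \<open>P\<close> is \<open>u\<^sub>i\<close>, where \<open>i\<close> is the number of
  up steps among the positions \<open>0, \<dots>, j\<close>.\<close>

definition step_value :: "(nat \<Rightarrow> int) \<Rightarrow> step list \<Rightarrow> nat \<Rightarrow> int" where
  "step_value \<delta> P j =
     (case P ! j of U \<Rightarrow> \<delta> (count_list (take (Suc j) P) U) | D \<Rightarrow> - 1)"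

text \<open>The value of a subword depends on where it sits in \<open>P\<close>, so subwords are given by their
  starting position \<open>a\<close> and their length \<open>m\<close>.\<close>

definition subword_value :: "(nat \<Rightarrow> int) \<Rightarrow> step list \<Rightarrow> nat \<Rightarrow> nat \<Rightarrow> int" where
  "subword_value \<delta> P a m = (\<Sum>j\<in>{a..<a + m}. step_value \<delta> P j)"

definition is_excursion :: "(nat \<Rightarrow> int) \<Rightarrow> step list \<Rightarrow> nat \<Rightarrow> nat \<Rightarrow> bool" where
  "is_excursion \<delta> P a m \<longleftrightarrow>
     0 < m \<and> a + m \<le> length P \<and> P ! a = U \<and> subword_value \<delta> P a m = 0 \<and>
     (\<forall>m'. 0 < m' \<and> m' < m \<longrightarrow> subword_value \<delta> P a m' \<noteq> 0)"

text \<open>The excursion \<open>C\<close> starts with an up step, so \<open>[D] @ C\<close> begins with the valley at which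
  the rotation takes place.\<close>

definition rotation :: "(nat \<Rightarrow> int) \<Rightarrow> (step list \<times> step list) set" where
  "rotation \<delta> =
     {(A @ [D] @ C @ B, A @ C @ [D] @ B) | A B C.
        is_excursion \<delta> (A @ [D] @ C @ B) (Suc (length A)) (length C)}"

definition alt_tamari :: "nat \<Rightarrow> (nat \<Rightarrow> int) \<Rightarrow> (step list \<times> step list) set" where
  "alt_tamari n \<delta> = Restr ((Restr (rotation \<delta>) (dyck_paths n))\<^sup>*) (dyck_paths n)"

end

theory Submission
  imports Defs
begin

text \<open>
  A Dyck path \<open>P\<close> is encoded by the sequence \<open>s\<close> of the \<open>\<delta>\<close>-values \<open>s l\<close> of the prefix of \<open>P\<close> before
  its \<open>l\<close>-th up step. Between consecutive up steps there are
  \<open>s (l - 1) + \<delta> (l - 1) - s l\<close> down steps, so \<open>P\<close> has a valley at the \<open>j\<close>-th up step iff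
  \<open>s j < s (j - 1) + \<delta> (j - 1)\<close>, and the up steps in the excursion of the \<open>j\<close>-th one are those
  of indices \<open>j \<le> l < m\<close>, where \<open>m\<close> is the first index after \<open>j\<close> with \<open>s m \<le> s j\<close>. A rotation
  at \<open>j\<close> adds \<open>1\<close> to \<open>s\<close> on this block (\<open>vec_rotate\<close>). The whole order theory is done for such
  sequences, in the locale \<open>rise_vectors\<close>.

  Along a rotation \<open>s\<close> does not decrease at any index, and neither does \<open>s l - s j\<close> whenever \<open>l\<close> lies
  in the block of \<open>j\<close>, because blocks are nested or disjoint (\<open>expands_raise\<close>). This makes the order antisymmetric
  and rotations at different places incomparable, and it pins down two families of intervals that
  are chains with \<open>k + 1\<close> elements (\<open>left_pairs_linear\<close>, \<open>right_pairs_linear\<close>): the left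
  ones, \<open>A d\<^sup>k C B \<le> A C d\<^sup>k B\<close>, rotate \<open>k\<close> times the same excursion, and the right
  ones, \<open>A d C\<^sub>1 \<dots> C\<^sub>k B \<le> A C\<^sub>1 \<dots> C\<^sub>k d B\<close>, rotate \<open>k\<close> successive
  excursions. Conversely, two rotations in a row either
  form a left or a right interval or can be completed to a square or a pentagon, which contains two
  incomparable elements (\<open>commute\<close>). Of three rotations in a row, the first two cannot form a
  left and the last two a right interval, and right ones followed by
  left ones give another pentagon (\<open>pentagon\<close>). Hence every linear interval of height \<open>k \<ge> 1\<close> is left or right
  (\<open>linear_pairs_order\<close>); the two families coincide for \<open>k = 1\<close> and are disjoint for \<open>k \<ge> 2\<close>.

  It remains to see that both families have \<open>2 n - k\<close> choose \<open>n - k - 1\<close> members. A right interval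
  is a Dyck path with a marked down step followed by \<open>k\<close> successive excursions. The number of
  words completing a prefix of height \<open>h\<close> with \<open>N\<close> up steps, such that \<open>k\<close> successive excursions
  follow the first moment when the \<open>\<delta>\<close>-value has decreased by \<open>j \<le> h\<close>, satisfies a recursion on
  the first letter whose solution, the ballot number of \<open>(h + k, N - k)\<close>, involves neither \<open>\<delta>\<close>
  nor \<open>j\<close> (\<open>card_run_words\<close>). Summing over the marked down step gives the closed form of
  \<open>card_marked\<close>. A left interval is a Dyck path with a marked factor \<open>d\<^sup>k u\<close>; reversing
  the path turns it into a marked \<open>d u\<^sup>k\<close>, which is the right family for \<open>\<delta> = 0\<close>
  (\<open>card_marked_descents\<close>).
\<close>

section \<open>Linear intervals in posets\<close>

text \<open>The linear intervals of height \<open>k\<close>, given by their end points instead of as sets.\<close>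

definition linear_pairs :: "('a \<times> 'a) set \<Rightarrow> nat \<Rightarrow> ('a \<times> 'a) set" where
  "linear_pairs r k =
     {(P, Q). (P, Q) \<in> r \<and> total_on (interval r P Q) r \<and> height r P Q = k}"

lemma card_linear_intervals:
  assumes "antisym r" and refl: "\<And>P Q. (P, Q) \<in> r \<Longrightarrow> (P, P) \<in> r \<and> (Q, Q) \<in> r"
  shows "card (linear_intervals r k) = card (linear_pairs r k)"
proof -
  have *: "linear_intervals r k = (\<lambda>(P, Q). interval r P Q) ` linear_pairs r k"
    unfolding linear_intervals_def linear_pairs_def by auto
  have "inj_on (\<lambda>(P, Q). interval r P Q) (linear_pairs r k)"
  proof (rule inj_onI, clarsimp simp: linear_pairs_def)
    fix P Q P' Q' assume "(P, Q) \<in> r" "(P', Q') \<in> r" "interval r P Q = interval r P' Q'"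
    moreover from this have "P \<in> interval r P' Q'" "Q \<in> interval r P' Q'"
      "P' \<in> interval r P Q" "Q' \<in> interval r P Q"
      using refl unfolding interval_def by blast+
    ultimately show "P = P' \<and> Q = Q'"
      using \<open>antisym r\<close> unfolding interval_def by (auto dest: antisymD)
  qed
  then show ?thesis unfolding * by (rule card_image)
qed

lemma relpow_map_prod:
  assumes inj: "inj_on f X" and r: "r \<subseteq> X \<times> X" and "P \<in> X"
  shows "(f P, y) \<in> (map_prod f f ` r - Id) ^^ m \<longleftrightarrow> (\<exists>Q\<in>X. y = f Q \<and> (P, Q) \<in> (r - Id) ^^ m)"
proof (induction m arbitrary: y)
  case 0
  then show ?case using \<open>P \<in> X\<close> by auto
next
  case (Suc m)
  define r' where "r' = map_prod f f ` r - Id"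
  have "(f P, y) \<in> r' ^^ Suc m \<longleftrightarrow> (\<exists>z. (f P, z) \<in> r' ^^ m \<and> (z, y) \<in> r')"
    by auto
  also have "\<dots> \<longleftrightarrow> (\<exists>R\<in>X. (P, R) \<in> (r - Id) ^^ m \<and> (f R, y) \<in> r')"
    unfolding Suc.IH[folded r'_def] by blast
  also have "\<dots> \<longleftrightarrow> (\<exists>R\<in>X. (P, R) \<in> (r - Id) ^^ m \<and> (\<exists>Q\<in>X. y = f Q \<and> (R, Q) \<in> r - Id))"
  proof -
    have "(f R, y) \<in> r' \<longleftrightarrow> (\<exists>Q\<in>X. y = f Q \<and> (R, Q) \<in> r - Id)" if "R \<in> X" for R
    proof
      assume "(f R, y) \<in> r'"
      then obtain R' Q where "(R', Q) \<in> r" "f R = f R'" "y = f Q" "f R \<noteq> y" by (auto simp: r'_def)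
      moreover from this have "R' = R" "Q \<in> X" using inj r \<open>R \<in> X\<close> by (auto dest: inj_onD)
      ultimately show "\<exists>Q\<in>X. y = f Q \<and> (R, Q) \<in> r - Id" by auto
    next
      assume "\<exists>Q\<in>X. y = f Q \<and> (R, Q) \<in> r - Id"
      then show "(f R, y) \<in> r'"
        using inj \<open>R \<in> X\<close> unfolding r'_def by (force dest: inj_onD)
    qed
    then show ?thesis by blast
  qed
  also have "\<dots> \<longleftrightarrow> (\<exists>Q\<in>X. y = f Q \<and> (P, Q) \<in> (r - Id) ^^ Suc m)"
  proof -
    have "R \<in> X" if "(R, Q) \<in> r - Id" for R Q using that r by auto
    then show ?thesis unfolding relpow.simps relcomp_unfold by blast
  qed
  finally show ?case unfolding r'_def .
qed

lemma linear_pairs_map_prod: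
  assumes inj: "inj_on f X" and r: "r \<subseteq> X \<times> X"
  shows "linear_pairs (map_prod f f ` r) k = map_prod f f ` linear_pairs r k"
proof -
  let ?r = "map_prod f f ` r"
  have mem: "(f P, f Q) \<in> ?r \<longleftrightarrow> (P, Q) \<in> r" if "P \<in> X" "Q \<in> X" for P Q
  proof
    assume "(f P, f Q) \<in> ?r"
    then obtain P' Q' where "(P', Q') \<in> r" "f P = f P'" "f Q = f Q'" by auto
    moreover from this have "P' = P" "Q' = Q" using inj r that by (auto dest: inj_onD)
    ultimately show "(P, Q) \<in> r" by simp
  next
    assume "(P, Q) \<in> r"
    then show "(f P, f Q) \<in> ?r" by (metis image_eqI map_prod_simp)
  qed
  have int: "interval ?r (f P) (f Q) = f ` interval r P Q" if "P \<in> X" "Q \<in> X" for P Q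
  proof
    show "interval ?r (f P) (f Q) \<subseteq> f ` interval r P Q"
    proof
      fix y assume "y \<in> interval ?r (f P) (f Q)"
      then have y: "(f P, y) \<in> ?r" "(y, f Q) \<in> ?r" by (auto simp: interval_def)
      then obtain R where "R \<in> X" "y = f R" using r by auto
      with y mem that show "y \<in> f ` interval r P Q" by (auto simp: interval_def)
    qed
    show "f ` interval r P Q \<subseteq> interval ?r (f P) (f Q)"
      by (force simp: interval_def)
  qed
  have sub: "interval r P Q \<subseteq> X" for P Q using r by (auto simp: interval_def)
  have tot: "total_on (interval ?r (f P) (f Q)) ?r \<longleftrightarrow> total_on (interval r P Q) r"
    if "P \<in> X" "Q \<in> X" for P Q
  proof -
    have "f R \<noteq> f S \<longleftrightarrow> R \<noteq> S" "(f R, f S) \<in> ?r \<longleftrightarrow> (R, S) \<in> r" "(f S, f R) \<in> ?r \<longleftrightarrow> (S, R) \<in> r"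
      if "R \<in> interval r P Q" "S \<in> interval r P Q" for R S
    proof -
      have "R \<in> X" "S \<in> X" using that sub by auto
      then show "f R \<noteq> f S \<longleftrightarrow> R \<noteq> S" "(f R, f S) \<in> ?r \<longleftrightarrow> (R, S) \<in> r" "(f S, f R) \<in> ?r \<longleftrightarrow> (S, R) \<in> r"
        using mem[of R S] mem[of S R] inj_on_eq_iff[OF inj, of R S] by simp_all
    qed
    then show ?thesis unfolding int[OF that] total_on_def ball_simps by (intro ball_cong refl) simp
  qed
  have ht: "height ?r (f P) (f Q) = height r P Q" if "P \<in> X" "Q \<in> X" for P Q
    unfolding height_def relpow_map_prod[OF inj r \<open>P \<in> X\<close>]
  proof -
    have "(\<exists>Q'\<in>X. f Q = f Q' \<and> (P, Q') \<in> (r - Id) ^^ m) \<longleftrightarrow> (P, Q) \<in> (r - Id) ^^ m" for m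
      using inj_onD[OF inj, of Q] that by blast
    then show "(GREATEST m. \<exists>Q'\<in>X. f Q = f Q' \<and> (P, Q') \<in> (r - Id) ^^ m) =
        (GREATEST m. (P, Q) \<in> (r - Id) ^^ m)" by simp
  qed
  show ?thesis
  proof (intro set_eqI iffI)
    fix z assume z: "z \<in> linear_pairs ?r k"
    then obtain P Q where "(P, Q) \<in> r" "z = (f P, f Q)" by (auto simp: linear_pairs_def)
    moreover from this have "P \<in> X" "Q \<in> X" using r by auto
    ultimately have "(P, Q) \<in> linear_pairs r k"
      using z tot[of P Q] ht[of P Q] by (simp add: linear_pairs_def)
    then show "z \<in> map_prod f f ` linear_pairs r k"
      using \<open>z = (f P, f Q)\<close> by (metis image_eqI map_prod_simp)
  next
    fix z assume "z \<in> map_prod f f ` linear_pairs r k"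
    then obtain P Q where "(P, Q) \<in> linear_pairs r k" "z = (f P, f Q)" by auto
    moreover from this have "P \<in> X" "Q \<in> X" using r by (auto simp: linear_pairs_def)
    ultimately show "z \<in> linear_pairs ?r k"
      using tot[of P Q] ht[of P Q] mem[of P Q] by (simp add: linear_pairs_def)
  qed
qed

text \<open>An interval that consists of the members of a strictly increasing sequence
  \<open>c 0, \<dots>, c k\<close> is linear of height \<open>k\<close>.\<close>

lemma linear_pair_chain:
  assumes r: "antisym r" "trans r"
    and refl: "\<And>t. t \<le> k \<Longrightarrow> (c t, c t) \<in> r"
    and step: "\<And>t. t < k \<Longrightarrow> (c t, c (Suc t)) \<in> r - Id"
    and int: "interval r (c 0) (c k) \<subseteq> c ` {0..k}"
  shows "(c 0, c k) \<in> linear_pairs r k"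
proof -
  have le: "(c a, c b) \<in> r" if "a \<le> b" "b \<le> k" for a b
    using that
  proof (induction b)
    case 0
    then show ?case using refl by auto
  next
    case (Suc b)
    then show ?case using refl[of "Suc b"] step[of b] r(2)
      by (cases "a = Suc b") (auto dest: transD)
  qed
  have bound: "\<exists>a. x = c a \<and> a + m \<le> k"
    if "(c 0, x) \<in> r" "(x, c k) \<in> (r - Id) ^^ m" for x m
    using that
  proof (induction m arbitrary: x)
    case 0
    then show ?case by auto
  next
    case (Suc m)
    from relpow_Suc_D2[OF Suc.prems(2)] obtain y
      where y: "(x, y) \<in> r - Id" "(y, c k) \<in> (r - Id) ^^ m" by blast
    have "(c 0, y) \<in> r" using y Suc.prems r(2) by (auto dest: transD)
    from Suc.IH[OF this y(2)] obtain b where b: "y = c b" "b + m \<le> k" by auto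
    have "(y, c k) \<in> r" using le b by simp
    then have "(x, c k) \<in> r" using y r(2) by (auto dest: transD)
    then obtain a where a: "x = c a" "a \<le> k" using int Suc.prems(1) by (auto simp: interval_def)
    have "a < b"
    proof (rule ccontr)
      assume "\<not> a < b"
      then have "(y, x) \<in> r" using le[of b a] a b by simp
      then show False using y r(1) by (auto dest: antisymD)
    qed
    then show ?case using a b by auto
  qed
  have "(c 0, c j) \<in> (r - Id) ^^ j" if "j \<le> k" for j
    using that
  proof (induction j)
    case (Suc j)
    then show ?case using step[of j] by auto
  qed auto
  then have "height r (c 0) (c k) = k"
    unfolding height_def using bound[of "c 0"] refl[of 0]
    by (intro Greatest_equality) (simp, metis add_leD2 le0)
  moreover have "total_on (interval r (c 0) (c k)) r"
  proof (rule total_onI)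
    fix x y assume "x \<in> interval r (c 0) (c k)" "y \<in> interval r (c 0) (c k)"
    then have "x \<in> c ` {0..k}" "y \<in> c ` {0..k}" using int by blast+
    then obtain a b where "x = c a" "y = c b" "a \<le> k" "b \<le> k" by auto
    then show "(x, y) \<in> r \<or> (y, x) \<in> r" using le[of a b] le[of b a] by (cases "a \<le> b") auto
  qed
  ultimately show ?thesis using le[of 0 k] by (auto simp: linear_pairs_def)
qed

section \<open>Blocks of integer sequences\<close>

text \<open>The first index after \<open>j\<close> at which \<open>s\<close> is at most \<open>s j\<close>, or \<open>n + 1\<close> if there is none among the
  indices up to \<open>n\<close>. The block \<open>{j..<nxt n s j}\<close> indexes the up steps in the excursion of the
  \<open>j\<close>-th one.\<close>

definition nxt :: "nat \<Rightarrow> (nat \<Rightarrow> int) \<Rightarrow> nat \<Rightarrow> nat" where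
  "nxt n s j = (LEAST m. j < m \<and> (n < m \<or> s m \<le> s j))"

text \<open>Adding a constant to a sequence on the indices in \<open>{a..<b}\<close>.\<close>

definition bump :: "(nat \<Rightarrow> int) \<Rightarrow> nat \<Rightarrow> nat \<Rightarrow> int \<Rightarrow> nat \<Rightarrow> int" where
  "bump s a b c = (\<lambda>l. if a \<le> l \<and> l < b then s l + c else s l)"

text \<open>The effect of a rotation at the \<open>j\<close>-th up step.\<close>

definition raise :: "nat \<Rightarrow> (nat \<Rightarrow> int) \<Rightarrow> nat \<Rightarrow> nat \<Rightarrow> int" where
  "raise n s j = bump s j (nxt n s j) 1"

text \<open>The \<open>j\<close>-th up step is preceded by at least \<open>k\<close> consecutive down steps. There is no up step before
  the first one, whence \<open>1 < j\<close>; no down step precedes the first up step of a Dyck path.\<close>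

definition drop_before :: "nat \<Rightarrow> (nat \<Rightarrow> int) \<Rightarrow> nat \<Rightarrow> (nat \<Rightarrow> int) \<Rightarrow> nat \<Rightarrow> bool" where
  "drop_before n d k s j \<longleftrightarrow> 1 < j \<and> j \<le> n \<and> s j + int k \<le> s (j - 1) + d (j - 1)"

lemma nxt_exists: "\<exists>m. j < m \<and> (n < m \<or> s m \<le> s j)"
  for j n :: nat
  by (rule exI[of _ "Suc (max j n)"]) auto

lemma nxt_gt: "j < nxt n s j"
  and nxt_end: "n < nxt n s j \<or> s (nxt n s j) \<le> s j"
  unfolding nxt_def using LeastI_ex[OF nxt_exists[of j n s]] by auto

lemma nxt_inside:
  assumes "j < l" "l < nxt n s j" shows "l \<le> n" "s j < s l"
  using not_less_Least[of l "\<lambda>m. j < m \<and> (n < m \<or> s m \<le> s j)"] assms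
  unfolding nxt_def by auto

lemma nxt_eqI:
  assumes "j < m" "\<And>l. j < l \<Longrightarrow> l < m \<Longrightarrow> l \<le> n \<and> s j < s l" "n < m \<or> s m \<le> s j"
  shows "nxt n s j = m"
  unfolding nxt_def using assms by (intro Least_equality) (auto simp: not_less[symmetric])

lemma less_nxtI:
  assumes "\<And>l. j < l \<Longrightarrow> l \<le> m \<Longrightarrow> l \<le> n \<and> s j < s l" "j \<le> m"
  shows "m < nxt n s j"
proof (rule ccontr)
  assume "\<not> m < nxt n s j"
  then show False
    using assms(1)[of "nxt n s j"] nxt_gt[of j n s] nxt_end[of n s j] by linarith
qed

lemma nxt_le: "j \<le> n \<Longrightarrow> nxt n s j \<le> Suc n"
  unfolding nxt_def by (rule Least_le) auto

text \<open>A coarser relation than the order generated by the rotations, but described directly by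
  inequalities: besides \<open>s \<le> t\<close>, the elevation of each index above the start of a block that
  contains it does not decrease.\<close>

definition expands :: "nat \<Rightarrow> (nat \<Rightarrow> int) \<Rightarrow> (nat \<Rightarrow> int) \<Rightarrow> bool" where
  "expands n s t \<longleftrightarrow>
     (\<forall>l. s l \<le> t l) \<and> (\<forall>j l. j \<le> l \<and> l < nxt n s j \<longrightarrow> s l - s j \<le> t l - t j)"

text \<open>Blocks grow.\<close>

lemma expands_nxt:
  assumes "expands n s t" "j \<le> l" "l < nxt n s j" shows "l < nxt n t j"
proof (rule less_nxtI)
  fix m assume m: "j < m" "m \<le> l"
  then have "m < nxt n s j" using assms by simp
  from nxt_inside[OF m(1) this] show "m \<le> n \<and> t j < t m"
    using assms(1) m \<open>m < nxt n s j\<close> unfolding expands_def by (smt (verit) less_imp_le)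
qed (use assms in simp)

lemma expands_trans:
  assumes "expands n s t" "expands n t u" shows "expands n s u"
proof -
  have "s l \<le> u l" for l using assms unfolding expands_def by (meson order_trans)
  moreover have "s l - s j \<le> u l - u j" if "j \<le> l" "l < nxt n s j" for j l
    using expands_nxt[OF assms(1) that] assms that unfolding expands_def by (meson order_trans)
  ultimately show ?thesis by (simp add: expands_def)
qed

lemma expands_refl: "expands n s s"
  by (simp add: expands_def)

lemma expands_antisym: "expands n s t \<Longrightarrow> expands n t s \<Longrightarrow> s = t"
  unfolding expands_def by (meson antisym ext)

lemma nxt_nested:
  assumes "i \<le> j" "j < nxt n s i" shows "nxt n s j \<le> nxt n s i"
proof (rule ccontr)
  assume *: "\<not> nxt n s j \<le> nxt n s i"
  then have "s j < s (nxt n s i)" "nxt n s i \<le> n" using nxt_inside[of j "nxt n s i" n s] assms by auto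
  moreover have "s i \<le> s j" using nxt_inside[of i j n s] assms by (cases "i = j") auto
  ultimately show False using nxt_end[of n s i] by simp
qed

lemma expands_raise: "expands n s (raise n s i)"
proof -
  have "s l - s j \<le> raise n s i l - raise n s i j" if "j \<le> l" "l < nxt n s j" for j l
    using nxt_nested[of i j n s] that unfolding raise_def bump_def by auto
  then show ?thesis by (simp add: expands_def raise_def bump_def)
qed

lemma raise_neq: "raise n s j \<noteq> s"
  using nxt_gt[of j n s] by (auto simp: raise_def bump_def fun_eq_iff)

lemma raise_incomparable:
  assumes "expands n (raise n s i) (raise n s j)" shows "i = j"
proof (rule ccontr)
  assume "i \<noteq> j"
  have "raise n s i i \<le> raise n s j i" using assms by (simp add: expands_def)
  then have ij: "j < i" "i < nxt n s j"
    using nxt_gt[of i n s] \<open>i \<noteq> j\<close> by (auto simp: raise_def bump_def split: if_splits)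
  have "raise n s i i - raise n s i j \<le> raise n s j i - raise n s j j"
    using assms expands_nxt[OF expands_raise, of j i n s i] ij by (simp add: expands_def)
  then show False using ij nxt_gt[of i n s] nxt_gt[of j n s] by (simp add: raise_def bump_def)
qed

lemma bump_0 [simp]: "bump s a b 0 = s"
  by (simp add: bump_def fun_eq_iff)

lemma bump_empty [simp]: "bump s a a c = s"
  by (auto simp: bump_def fun_eq_iff)

lemma nxt_bump:
  assumes "0 \<le> c" shows "nxt n (bump s j (nxt n s j) c) j = nxt n s j"
proof (rule nxt_eqI)
  show "l \<le> n \<and> bump s j (nxt n s j) c j < bump s j (nxt n s j) c l"
    if "j < l" "l < nxt n s j" for l
    using that nxt_inside[OF that] by (simp add: bump_def)
qed (use assms nxt_gt[of j n s] nxt_end[of n s j] in \<open>auto simp: bump_def\<close>)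

section \<open>Linear intervals in the order on sequences\<close>

text \<open>The properties of the sequences of Dyck paths that the order theory uses. The upper
  bound in \<open>rise\<close> is attained when no down step separates two up steps.\<close>

locale rise_vectors =
  fixes n :: nat and d :: "nat \<Rightarrow> int" and X :: "(nat \<Rightarrow> int) set"
  assumes d_nonneg: "1 \<le> l \<Longrightarrow> l \<le> n \<Longrightarrow> 0 \<le> d l"
    and rise: "s \<in> X \<Longrightarrow> 1 < l \<Longrightarrow> l \<le> n \<Longrightarrow> s l \<le> s (l - 1) + d (l - 1)"
    and raise_closed: "s \<in> X \<Longrightarrow> drop_before n d 1 s j \<Longrightarrow> raise n s j \<in> X"
begin

abbreviation nx where "nx \<equiv> nxt n"
abbreviation "db \<equiv> drop_before n d"

text \<open>The rotations.\<close>

definition cover :: "((nat \<Rightarrow> int) \<times> (nat \<Rightarrow> int)) set" where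
  "cover = {(s, raise n s j) | s j. s \<in> X \<and> db 1 s j}"

definition order :: "((nat \<Rightarrow> int) \<times> (nat \<Rightarrow> int)) set" where
  "order = Restr (cover\<^sup>*) X"

lemma coverI: "s \<in> X \<Longrightarrow> db 1 s j \<Longrightarrow> (s, raise n s j) \<in> cover"
  by (auto simp: cover_def)

lemma cover_sub: "(s, t) \<in> cover \<Longrightarrow> s \<in> X \<and> t \<in> X"
  using raise_closed by (auto simp: cover_def)

lemma rtrancl_cover_order: "(s, t) \<in> cover\<^sup>* \<Longrightarrow> s \<in> X \<Longrightarrow> (s, t) \<in> order"
  by (induction rule: rtrancl_induct) (auto simp: order_def cover_sub)

lemma order_expands: "(s, t) \<in> order \<Longrightarrow> expands n s t"
proof -
  have "(s, t) \<in> cover\<^sup>* \<Longrightarrow> expands n s t"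
    by (induction rule: rtrancl_induct)
      (auto simp: cover_def expands_refl intro: expands_trans expands_raise)
  then show "(s, t) \<in> order \<Longrightarrow> expands n s t" by (simp add: order_def)
qed

lemma antisym_order: "antisym order"
  using order_expands expands_antisym by (blast intro: antisymI)

lemma trans_order: "trans order"
  unfolding order_def by (rule transI) (auto intro: rtrancl_trans)

lemma order_refl: "s \<in> X \<Longrightarrow> (s, s) \<in> order"
  by (simp add: order_def)

lemma cover_order: "(s, t) \<in> cover \<Longrightarrow> (s, t) \<in> order"
  using cover_sub by (auto simp: order_def)

text \<open>Let a rotation at \<open>i\<close> be followed by a rotation at \<open>j \<noteq> i\<close>, where the excursion of \<open>j\<close> does not
  directly follow that of \<open>i\<close>. Then one can also rotate at \<open>j\<close> first and reach the same element. If
  the excursion of \<open>j\<close> ends with the down step before \<open>i\<close>, then this takes two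
  more rotations at \<open>i\<close>; in all other cases it takes one.\<close>

lemma commute:
  assumes s: "s \<in> X" and i: "db 1 s i" and j: "db 1 (raise n s i) j" and "j \<noteq> i"
    and not_right: "\<not> (j = nx s i \<and> s j = s i)"
  shows "db 1 s j" and "(raise n s j, raise n (raise n s i) j) \<in> cover\<^sup>*"
proof -
  define a where "a = nx s i"
  define b where "b = nx s j"
  define t where "t = raise n s i"
  define v where "v = raise n s j"
  have t: "t l = (if i \<le> l \<and> l < a then s l + 1 else s l)" for l
    by (simp add: t_def raise_def bump_def a_def)
  have v: "v l = (if j \<le> l \<and> l < b then s l + 1 else s l)" for l
    by (simp add: v_def raise_def bump_def b_def)
  have a: "i < a" "\<And>l. i < l \<Longrightarrow> l < a \<Longrightarrow> l \<le> n \<and> s i < s l" "n < a \<or> s a \<le> s i"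
    using nxt_gt nxt_inside nxt_end unfolding a_def by blast+
  have b: "j < b" "\<And>l. j < l \<Longrightarrow> l < b \<Longrightarrow> l \<le> n \<and> s j < s l" "n < b \<or> s b \<le> s j"
    using nxt_gt nxt_inside nxt_end unfolding b_def by blast+
  have i1: "1 < i" "i \<le> n" "s i + 1 \<le> s (i - 1) + d (i - 1)"
    using i by (auto simp: drop_before_def)
  have j1: "1 < j" "j \<le> n" "t j + 1 \<le> t (j - 1) + d (j - 1)"
    using j by (auto simp: drop_before_def t_def)
  \<comment> \<open>If the rotation at \<open>i\<close> created the valley at \<open>j\<close>, then \<open>j\<close> would directly follow the excursion
    of \<open>i\<close>.\<close>
  show dbj: "db 1 s j"
  proof (rule ccontr)
    assume "\<not> db 1 s j"
    then have *: "s (j - 1) + d (j - 1) < s j + 1" using j1 by (simp add: drop_before_def)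
    then have "i \<le> j - 1" "j - 1 < a" "\<not> j < a" using j1(3) t[of j] t[of "j - 1"] \<open>j \<noteq> i\<close>
      by (auto split: if_splits)
    then have "j = a" by simp
    then have "s j < s i" using a(3) not_right j1 by (auto simp: a_def)
    moreover have "s i \<le> s (j - 1)"
      using a(2)[of "j - 1"] \<open>i \<le> j - 1\<close> \<open>j - 1 < a\<close> by (cases "i = j - 1") auto
    moreover have "0 \<le> d (j - 1)" using d_nonneg[of "j - 1"] \<open>i \<le> j - 1\<close> i1 j1 by simp
    ultimately show False using * by simp
  qed
  have vX: "v \<in> X" and tX: "t \<in> X" using s i dbj raise_closed by (auto simp: v_def t_def)
  have j2: "s j + 1 \<le> s (j - 1) + d (j - 1)" using dbj by (simp add: drop_before_def)
  have square: "(v, raise n t j) \<in> cover\<^sup>*"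
    if "nx t j = b" "nx v i = a" "v i + 1 \<le> v (i - 1) + d (i - 1)"
  proof -
    have "raise n v i l = raise n t j l" for l
      using that by (simp add: raise_def bump_def t v)
    then have "raise n v i = raise n t j" by blast
    moreover have "db 1 v i" using that i1 by (simp add: drop_before_def)
    ultimately show ?thesis using coverI[OF vX] by (metis r_into_rtrancl)
  qed
  consider "i < j" "j < a" | "j < i" "i < b" | "i < j" "a \<le> j" | "j < i" "b \<le> i"
    using \<open>j \<noteq> i\<close> by linarith
  then have "(v, raise n t j) \<in> cover\<^sup>*"
  proof cases
    case 1
    then have "b \<le> a" using nxt_nested[of i j n s] by (simp add: a_def b_def)
    show ?thesis
    proof (rule square)
      show "nx t j = b"
      proof (rule nxt_eqI)
        show "j < b" using 1 \<open>b \<le> a\<close> a(1) b(1) by simp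
        show "l \<le> n \<and> t j < t l" if "j < l" "l < b" for l
          using that 1 \<open>b \<le> a\<close> a(1) b(1) a(2)[of l] b(2)[of l] by (auto simp: t)
        show "n < b \<or> t b \<le> t j" using 1 \<open>b \<le> a\<close> a(1,3) b(1,3) by (auto simp: t)
      qed
      show "nx v i = a"
      proof (rule nxt_eqI)
        show "i < a" using 1 \<open>b \<le> a\<close> a(1) b(1) by simp
        show "l \<le> n \<and> v i < v l" if "i < l" "l < a" for l
          using that 1 \<open>b \<le> a\<close> a(1) b(1) a(2)[of l] b(2)[of l] by (auto simp: v)
        show "n < a \<or> v a \<le> v i" using 1 \<open>b \<le> a\<close> a(1,3) b(1,3) by (auto simp: v)
      qed
      show "v i + 1 \<le> v (i - 1) + d (i - 1)" using 1 i1 by (simp add: v)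
    qed
  next
    case 2
    then have "a \<le> b" using nxt_nested[of j i n s] by (simp add: a_def b_def)
    show ?thesis
    proof (rule square)
      show "nx t j = b"
      proof (rule nxt_eqI)
        show "j < b" using 2 \<open>a \<le> b\<close> a(1) b(1) by simp
        show "l \<le> n \<and> t j < t l" if "j < l" "l < b" for l
          using that 2 \<open>a \<le> b\<close> a(1) b(1) a(2)[of l] b(2)[of l] by (auto simp: t)
        show "n < b \<or> t b \<le> t j" using 2 \<open>a \<le> b\<close> a(1,3) b(1,3) by (auto simp: t)
      qed
      show "nx v i = a"
      proof (rule nxt_eqI)
        show "i < a" using 2 \<open>a \<le> b\<close> a(1) b(1) by simp
        show "l \<le> n \<and> v i < v l" if "i < l" "l < a" for l
          using that 2 \<open>a \<le> b\<close> a(1) b(1) a(2)[of l] b(2)[of l] by (auto simp: v)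
        show "n < a \<or> v a \<le> v i" using 2 \<open>a \<le> b\<close> a(1,3) b(1,3) by (auto simp: v)
      qed
      have "j \<le> i - 1" "i - 1 < b" using 2 by auto
      then show "v i + 1 \<le> v (i - 1) + d (i - 1)" using 2 i1 by (simp add: v)
    qed
  next
    case 3
    then have ja: "j = a \<Longrightarrow> s j < s i" using a(3) not_right j1 by (auto simp: a_def)
    show ?thesis
    proof (rule square)
      show "nx t j = b"
      proof (rule nxt_eqI)
        show "j < b" using 3 a(1) b(1) by simp
        show "l \<le> n \<and> t j < t l" if "j < l" "l < b" for l
          using that 3 a(1) b(1) a(2)[of l] b(2)[of l] by (auto simp: t)
        show "n < b \<or> t b \<le> t j" using 3 a(1,3) b(1,3) by (auto simp: t)
      qed
      show "nx v i = a"
      proof (rule nxt_eqI)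
        show "i < a" using 3 ja a(1) b(1) by simp
        show "l \<le> n \<and> v i < v l" if "i < l" "l < a" for l
          using that 3 ja a(1) b(1) a(2)[of l] b(2)[of l] by (auto simp: v)
        show "n < a \<or> v a \<le> v i" using 3 ja a(1,3) b(1,3) by (auto simp: v)
      qed
      show "v i + 1 \<le> v (i - 1) + d (i - 1)" using 3 i1 by (simp add: v)
    qed
  next
    case 4
    have vi: "nx v i = a"
    proof (rule nxt_eqI)
      show "i < a" using 4 a(1) b(1) by simp
      show "l \<le> n \<and> v i < v l" if "i < l" "l < a" for l
        using that 4 a(1) b(1) a(2)[of l] b(2)[of l] by (auto simp: v)
      show "n < a \<or> v a \<le> v i" using 4 a(1,3) b(1,3) by (auto simp: v)
    qed
    have dv: "v i + 1 \<le> v (i - 1) + d (i - 1)" using 4 i1 by (auto simp: v)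
    show ?thesis
    proof (cases "b = i \<and> s i = s j")
      case False
      then have ne: "b = i \<Longrightarrow> s i < s j" using b(3) i1 by auto
      have "nx t j = b"
      proof (rule nxt_eqI)
        show "j < b" using 4 ne a(1) b(1) by simp
        show "l \<le> n \<and> t j < t l" if "j < l" "l < b" for l
          using that 4 ne a(1) b(1) a(2)[of l] b(2)[of l] by (auto simp: t)
        show "n < b \<or> t b \<le> t j" using 4 ne a(1,3) b(1,3) by (auto simp: t)
      qed
      then show ?thesis using square vi dv by blast
    next
      case True
      \<comment> \<open>The pentagon: the block of \<open>j\<close> ends at \<open>i\<close> in \<open>s\<close>, but contains that of \<open>i\<close> in \<open>t\<close>.\<close>
      define w where "w = raise n v i"
      have w: "w l = (if i \<le> l \<and> l < a then v l + 1 else v l)" for l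
        by (simp add: w_def raise_def bump_def vi)
      have tj: "nx t j = a"
      proof (rule nxt_eqI)
        show "j < a" using True 4 a(1) b(1) by simp
        show "l \<le> n \<and> t j < t l" if "j < l" "l < a" for l
          using that True 4 i1 a(1) b(1) a(2)[of l] b(2)[of l] by (cases "l = i") (auto simp: t)
        show "n < a \<or> t a \<le> t j" using True 4 a(1,3) b(1,3) by (auto simp: t)
      qed
      have wi: "nx w i = a"
      proof (rule nxt_eqI)
        show "i < a" using 4 a(1) b(1) by simp
        show "l \<le> n \<and> w i < w l" if "i < l" "l < a" for l
          using that 4 a(1) b(1) a(2)[of l] b(2)[of l] by (auto simp: v w)
        show "n < a \<or> w a \<le> w i" using 4 a(1,3) b(1,3) by (auto simp: v w)
      qed
      have "db 1 v i" using dv i1 by (simp add: drop_before_def)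
      then have "(v, w) \<in> cover" using coverI[OF vX] by (simp add: w_def)
      moreover have "db 1 w i" using True 4 i1 by (auto simp: drop_before_def w v)
      then have "(w, raise n w i) \<in> cover" using coverI cover_sub[OF calculation] by simp
      moreover have "raise n w i l = raise n t j l" for l
        using True 4 a b by (auto simp: raise_def bump_def wi tj t v w)
      then have "raise n w i = raise n t j" by blast
      ultimately show ?thesis by (metis rtrancl.simps)
    qed
  qed
  then show "(raise n s j, raise n (raise n s i) j) \<in> cover\<^sup>*" by (simp add: t_def v_def)
qed

text \<open>A rotation at \<open>i\<close>, followed by two rotations at the excursion \<open>j\<close> directly after that of \<open>i\<close>. The
  excursion of \<open>i\<close> then ends with a down step, so rotating first at \<open>j\<close> moves the excursion of
  \<open>j\<close> into that of \<open>i\<close>, and a single rotation at \<open>i\<close> reaches the same element.\<close>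

lemma pentagon:
  assumes s: "s \<in> X" and i: "db 1 s i" and j: "j = nx s i" "j \<le> n" "s j = s i"
    and jj: "db 1 (raise n (raise n s i) j) j"
  shows "db 1 s j"
    and "(raise n s j, raise n (raise n (raise n s i) j) j) \<in> cover"
proof -
  define b where "b = nx s j"
  define t where "t = raise n s i"
  define v where "v = raise n s j"
  define u where "u = raise n t j"
  have a: "i < j" "\<And>l. i < l \<Longrightarrow> l < j \<Longrightarrow> l \<le> n \<and> s i < s l"
    using nxt_gt nxt_inside unfolding j(1) by blast+
  have b: "j < b" "\<And>l. j < l \<Longrightarrow> l < b \<Longrightarrow> l \<le> n \<and> s j < s l" "n < b \<or> s b \<le> s j"
    using nxt_gt nxt_inside nxt_end unfolding b_def by blast+
  have t: "t l = (if i \<le> l \<and> l < j then s l + 1 else s l)" for l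
    by (simp add: t_def raise_def bump_def j(1)[symmetric])
  have v: "v l = (if j \<le> l \<and> l < b then s l + 1 else s l)" for l
    by (simp add: v_def raise_def bump_def b_def)
  have nt: "nx t j = b"
  proof (rule nxt_eqI)
    show "l \<le> n \<and> t j < t l" if "j < l" "l < b" for l
      using that a(1) b(2)[of l] by (auto simp: t)
  qed (use a(1) b(1,3) in \<open>auto simp: t\<close>)
  have u: "u l = (if j \<le> l \<and> l < b then t l + 1 else t l)" for l
    by (simp add: u_def raise_def bump_def nt)
  have nu: "nx u j = b"
  proof (rule nxt_eqI)
    show "l \<le> n \<and> u j < u l" if "j < l" "l < b" for l
      using that a(1) b(2)[of l] by (auto simp: t u)
  qed (use a(1) b(1,3) in \<open>auto simp: t u\<close>)
  have nv: "nx v i = b"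
  proof (rule nxt_eqI)
    show "i < b" using a b by simp
    show "l \<le> n \<and> v i < v l" if "i < l" "l < b" for l
      using that j a(1) a(2)[of l] b(1) b(2)[of l] by (cases l j rule: linorder_cases) (auto simp: v)
    show "n < b \<or> v b \<le> v i" using b(3) j a(1) by (auto simp: v)
  qed
  have i1: "1 < i" "i \<le> n" "s i + 1 \<le> s (i - 1) + d (i - 1)"
    using i by (auto simp: drop_before_def)
  show dj: "db 1 s j"
    using jj a(1) b(1) i1 j unfolding drop_before_def t_def[symmetric] u_def[symmetric]
    by (auto simp: t u split: if_splits)
  have "db 1 v i" using i1 a(1) by (auto simp: drop_before_def v)
  then have "(v, raise n v i) \<in> cover" using coverI raise_closed[OF s dj] by (simp add: v_def)
  moreover have "raise n v i l = raise n u j l" for l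
    using a(1) b(1) by (auto simp: raise_def bump_def nv nu t u v)
  then have "raise n v i = raise n u j" by blast
  ultimately show "(raise n s j, raise n (raise n (raise n s i) j) j) \<in> cover"
    by (simp add: t_def u_def v_def)
qed

text \<open>From an element of a linear interval, at most one rotation leads to an element of the interval.\<close>

lemma linear_branch:
  assumes tot: "total_on (interval order s t) order" and x: "(s, x) \<in> order"
    and i: "db 1 x i" "(raise n x i, t) \<in> order" and j: "db 1 x j" "(raise n x j, t) \<in> order"
  shows "i = j"
proof (rule ccontr)
  assume "i \<noteq> j"
  have X: "x \<in> X" using x by (auto simp: order_def)
  then have "(s, raise n x i) \<in> order" "(s, raise n x j) \<in> order"
    using coverI[OF X] i j x cover_order transD[OF trans_order] by blast+
  then have "raise n x i \<in> interval order s t" "raise n x j \<in> interval order s t"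
    using i j by (auto simp: interval_def)
  moreover have "raise n x i \<noteq> raise n x j"
    using raise_incomparable[of n x i j] \<open>i \<noteq> j\<close> expands_refl by metis
  ultimately have "(raise n x i, raise n x j) \<in> order \<or> (raise n x j, raise n x i) \<in> order"
    using tot by (simp add: total_on_def)
  then show False using order_expands raise_incomparable \<open>i \<noteq> j\<close> by blast
qed

text \<open>From the \<open>j\<close>-th up step on there are \<open>k\<close> successive excursions: equality of the values means that
  no down step separates them.\<close>

definition run :: "(nat \<Rightarrow> int) \<Rightarrow> nat \<Rightarrow> nat \<Rightarrow> bool" where
  "run s j k \<longleftrightarrow> (\<forall>t<k. (nx s ^^ t) j \<le> n \<and> s ((nx s ^^ t) j) = s j)"

text \<open>The end points of the left intervals of height \<open>k\<close>.\<close>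

definition left_pairs where
  "left_pairs k = (\<lambda>(s, j). (s, bump s j (nx s j) (int k))) ` {(s, j). s \<in> X \<and> db k s j}"

text \<open>The end points of the right intervals of height \<open>k\<close>.\<close>

definition right_pairs where
  "right_pairs k = (\<lambda>(s, j). (s, bump s j ((nx s ^^ k) j) 1)) `
     {(s, j). s \<in> X \<and> db 1 s j \<and> run s j k}"

lemma left_chain:
  assumes s: "s \<in> X" and j: "db k s j" and "t < k"
  defines "c \<equiv> \<lambda>t. bump s j (nx s j) (int t)"
  shows "nx (c t) j = nx s j" "raise n (c t) j = c (Suc t)" "db 1 (c t) j" "(s, c t) \<in> order"
proof -
  have nx: "nx (c t) j = nx s j" for t
    by (simp add: c_def nxt_bump)
  have raise: "raise n (c t) j = c (Suc t)" for t
    unfolding raise_def nx by (auto simp: c_def bump_def fun_eq_iff)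
  have db: "db 1 (c t) j" if "t < k" for t
    using j that nxt_gt[of j n s] by (auto simp: drop_before_def c_def bump_def)
  have "(s, c t) \<in> order" if "t \<le> k" for t
    using that
  proof (induction t)
    case 0
    then show ?case using order_refl[OF s] by (simp add: c_def)
  next
    case (Suc t)
    then have "(s, c t) \<in> order" "c t \<in> X" by (auto simp: order_def)
    then show ?case
      using coverI[OF _ db[of t]] Suc.prems raise cover_order transD[OF trans_order]
      by (metis Suc_le_lessD)
  qed
  then show "nx (c t) j = nx s j" "raise n (c t) j = c (Suc t)" "db 1 (c t) j" "(s, c t) \<in> order"
    using nx raise db \<open>t < k\<close> by auto
qed

lemma right_chain:
  assumes s: "s \<in> X" and j: "db 1 s j" and run: "run s j k" and "t < k"
  defines "e \<equiv> \<lambda>t. (nx s ^^ t) j" and "c \<equiv> \<lambda>t. bump s j ((nx s ^^ t) j) 1"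
  shows "nx (c t) (e t) = e (Suc t)" "raise n (c t) (e t) = c (Suc t)" "db 1 (c t) (e t)"
    "(s, c t) \<in> order"
proof -
  have je: "j \<le> e t" for t
    by (induction t) (auto simp: e_def intro: order_trans less_imp_le[OF nxt_gt])
  have nx: "nx (c t) (e t) = e (Suc t)" for t
  proof -
    have "nx (c t) (e t) = nx s (e t)"
      unfolding nxt_def by (rule arg_cong[of _ _ Least]) (auto simp: c_def bump_def e_def fun_eq_iff)
    then show ?thesis by (simp add: e_def)
  qed
  have raise: "raise n (c t) (e t) = c (Suc t)" for t
    unfolding raise_def nx using je[of t] nxt_gt[of "e t" n s]
    by (auto simp: c_def e_def bump_def fun_eq_iff)
  have db: "db 1 (c t) (e t)" if "t < k" for t
  proof (cases t)
    case 0
    then show ?thesis using j by (simp add: c_def e_def bump_def drop_before_def)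
  next
    case (Suc t')
    then have "j < e t" using je[of t'] nxt_gt[of "e t'" n s] by (simp add: e_def)
    moreover have "1 < j" using j by (simp add: drop_before_def)
    moreover have "e t \<le> n" using run that by (simp add: run_def e_def)
    moreover from calculation have "s (e t) \<le> s (e t - 1) + d (e t - 1)" using rise[OF s] by simp
    moreover from calculation have "j \<le> e t - 1" "e t - 1 < e t" by linarith+
    ultimately show ?thesis by (auto simp: c_def e_def bump_def drop_before_def)
  qed
  have "(s, c t) \<in> order" if "t \<le> k" for t
    using that
  proof (induction t)
    case 0
    then show ?case using order_refl[OF s] by (simp add: c_def)
  next
    case (Suc t)
    then have "(s, c t) \<in> order" "c t \<in> X" by (auto simp: order_def)
    then show ?case
      using coverI[OF _ db[of t]] Suc.prems raise cover_order transD[OF trans_order]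
      by (metis Suc_le_lessD)
  qed
  then show "nx (c t) (e t) = e (Suc t)" "raise n (c t) (e t) = c (Suc t)" "db 1 (c t) (e t)"
    "(s, c t) \<in> order"
    using nx raise db \<open>t < k\<close> by auto
qed

lemma left_pairs_linear: "left_pairs k \<subseteq> linear_pairs order k"
proof (unfold left_pairs_def, rule image_subsetI, clarify)
  fix s j assume s: "s \<in> X" and j: "db k s j"
  define c where "c t = bump s j (nx s j) (int t)" for t
  note chain = left_chain[OF s j, folded c_def]
  have "(c 0, c k) \<in> linear_pairs order k"
  proof (rule linear_pair_chain[OF antisym_order trans_order])
    fix t assume "t < k"
    then have "(c t, c (Suc t)) \<in> cover" using chain[of t] coverI[of "c t" j] by (auto simp: order_def)
    moreover have "c (Suc t) \<noteq> c t" using chain[OF \<open>t < k\<close>] raise_neq by metis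
    ultimately show "(c t, c (Suc t)) \<in> order - Id" using cover_order by auto
  next
    fix t assume "t \<le> k"
    have "c t \<in> X"
    proof (cases t)
      case 0
      then show ?thesis using s by (simp add: c_def)
    next
      case (Suc t')
      then have "t' < k" using \<open>t \<le> k\<close> by simp
      from chain[OF this] show ?thesis
        using coverI[of "c t'" j] cover_sub Suc by (force simp: order_def)
    qed
    then show "(c t, c t) \<in> order" by (rule order_refl)
  next
    show "interval order (c 0) (c k) \<subseteq> c ` {0..k}"
    proof
      fix r assume "r \<in> interval order (c 0) (c k)"
      then have "expands n (c 0) r" "expands n r (c k)"
        using order_expands by (auto simp: interval_def)
      then have r: "expands n s r" "expands n r (c k)" by (auto simp: c_def)
      have le: "s l \<le> r l" "r l \<le> c k l" for l
        using r unfolding expands_def by auto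
      define t where "t = nat (r j - s j)"
      have "j < nx s j" by (rule nxt_gt)
      have tk: "t \<le> k" "r j = s j + int t"
        using le[of j] \<open>j < nx s j\<close> by (auto simp: t_def c_def bump_def)
      have "r l = c t l" for l
      proof (cases "j \<le> l \<and> l < nx s j")
        case True
        then have "s l - s j \<le> r l - r j" "r l - r j \<le> c k l - c k j"
          using r expands_nxt[OF r(1), of j l] unfolding expands_def by auto
        then show ?thesis using True tk \<open>j < nx s j\<close> by (auto simp: c_def bump_def)
      next
        case False
        then show ?thesis using le[of l] by (auto simp: c_def bump_def)
      qed
      then show "r \<in> c ` {0..k}" using tk by (auto simp: fun_eq_iff)
    qed
  qed
  then show "(s, bump s j (nx s j) (int k)) \<in> linear_pairs order k" by (simp add: c_def)
qed

lemma right_pairs_linear: "right_pairs k \<subseteq> linear_pairs order k"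
proof (unfold right_pairs_def, rule image_subsetI, clarify)
  fix s j assume s: "s \<in> X" and j: "db 1 s j" and run: "run s j k"
  define e where "e t = (nx s ^^ t) j" for t
  define c where "c t = bump s j (e t) 1" for t
  note chain = right_chain[OF s j run, folded e_def, folded c_def]
  have c0: "c 0 = s" by (auto simp: c_def e_def bump_def fun_eq_iff)
  have e_less: "e t < e (Suc t)" for t by (simp add: e_def nxt_gt)
  then have e_mono: "t \<le> t' \<Longrightarrow> e t \<le> e t'" for t t'
    by (simp add: lift_Suc_mono_le order_less_imp_le)
  have "(c 0, c k) \<in> linear_pairs order k"
  proof (rule linear_pair_chain[OF antisym_order trans_order])
    fix t assume "t < k"
    then have "(c t, c (Suc t)) \<in> cover"
      using chain[of t] coverI[of "c t" "e t"] by (auto simp: order_def)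
    moreover have "c (Suc t) \<noteq> c t" using chain[OF \<open>t < k\<close>] raise_neq by metis
    ultimately show "(c t, c (Suc t)) \<in> order - Id" using cover_order by auto
  next
    fix t assume "t \<le> k"
    have "c t \<in> X"
    proof (cases t)
      case 0
      then show ?thesis using s c0 by simp
    next
      case (Suc t')
      then have "t' < k" using \<open>t \<le> k\<close> by simp
      from chain[OF this] show ?thesis
        using coverI[of "c t'" "e t'"] cover_sub Suc by (force simp: order_def)
    qed
    then show "(c t, c t) \<in> order" by (rule order_refl)
  next
    show "interval order (c 0) (c k) \<subseteq> c ` {0..k}"
    proof
      fix r assume "r \<in> interval order (c 0) (c k)"
      then have r: "expands n s r" "expands n r (c k)"
        using order_expands c0 by (auto simp: interval_def)
      have le: "s l \<le> r l" "r l \<le> c k l" for l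
        using r unfolding expands_def by auto
      define x where "x t = r (e t) - s (e t)" for t
      have ck: "c k (e t) = s (e t) + 1" if "t < k" for t
        using that e_mono[of 0 t] e_mono[of "Suc t" k] e_less[of t]
        by (simp add: c_def bump_def e_def)
      have x01: "x t = 0 \<or> x t = 1" if "t < k" for t
        using le[of "e t"] ck[OF that] by (auto simp: x_def)
      \<comment> \<open>An element of the interval raises each of the \<open>k\<close> blocks as a whole, by \<open>0\<close> or \<open>1\<close>.\<close>
      have in_block: "r l = s l + x t" if "t < k" "e t \<le> l" "l < e (Suc t)" for t l
      proof -
        have l: "l < nx s (e t)" using that by (simp add: e_def)
        have "s l - s (e t) \<le> r l - r (e t)" "r l - r (e t) \<le> c k l - c k (e t)"
          using r expands_nxt[OF r(1) that(2) l] l that unfolding expands_def by auto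
        moreover have "c k l = s l + 1"
          using that e_mono[of 0 t] e_mono[of "Suc t" k] by (simp add: c_def bump_def e_def)
        ultimately show ?thesis using ck[OF that(1)] by (simp add: x_def)
      qed
      \<comment> \<open>Raising a block but not the previous one would put it inside the block of the previous one,
        at an elevation that the top of the interval does not have.\<close>
      have decreasing: "x (Suc t) = 0" if "Suc t < k" "x t = 0" for t
      proof (rule ccontr)
        assume "x (Suc t) \<noteq> 0"
        then have "x (Suc t) = 1" using x01 that by blast
        have same: "s (e t) = s j" "s (e (Suc t)) = s j" "e (Suc t) \<le> n"
          using run that by (auto simp: run_def e_def)
        have "e (Suc t) < nx r (e t)"
        proof (rule less_nxtI)
          fix l assume l: "e t < l" "l \<le> e (Suc t)"
          show "l \<le> n \<and> r (e t) < r l"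
          proof (cases "l = e (Suc t)")
            case True
            then show ?thesis using same \<open>x (Suc t) = 1\<close> that by (simp add: x_def)
          next
            case False
            then have less: "l < nx s (e t)" using l by (simp add: e_def)
            then have "l < e (Suc t)" by (simp add: e_def)
            with less show ?thesis using nxt_inside[OF l(1) less] in_block[of t l] in_block[of t "e t"] l that e_less[of t]
              by simp
          qed
        qed (use e_less[of t] in simp)
        then have "r (e (Suc t)) - r (e t) \<le> c k (e (Suc t)) - c k (e t)"
          using r(2) e_less[of t] unfolding expands_def by auto
        then show False using ck[of t] ck[of "Suc t"] that same \<open>x (Suc t) = 1\<close> by (simp add: x_def)
      qed
      define m where "m = (LEAST t. t = k \<or> x t = 0)"
      have m: "m = k \<or> x m = 0" unfolding m_def by (rule LeastI[of _ k]) simp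
      have "m \<le> k" unfolding m_def by (rule Least_le) simp
      have before: "x t = 1" if "t < m" for t
        using not_less_Least[of t "\<lambda>t. t = k \<or> x t = 0"] that x01[of t] \<open>m \<le> k\<close>
        unfolding m_def[symmetric] by auto
      have after: "x t = 0" if "m \<le> t" "t < k" for t
        using that
      proof (induction t)
        case 0
        then show ?case using m by auto
      next
        case (Suc t)
        then show ?case using decreasing[of t] m by (cases "m = Suc t") auto
      qed
      have blocks: "\<exists>t<k'. e t \<le> l \<and> l < e (Suc t)" if "j \<le> l" "l < e k'" for l k'
        using that
      proof (induction k')
        case 0
        then show ?case by (simp add: e_def)
      next
        case (Suc k')
        then show ?case by (cases "l < e k'") (auto intro: less_SucI)
      qed
      have "r l = c m l" for l
      proof (cases "j \<le> l \<and> l < e k")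
        case True
        then obtain t where t: "t < k" "e t \<le> l" "l < e (Suc t)" using blocks by blast
        show ?thesis
        proof (cases "t < m")
          case True
          then show ?thesis using in_block[OF t] before t e_mono[of "Suc t" m] e_mono[of 0 t]
            by (simp add: c_def bump_def e_def)
        next
          case False
          then show ?thesis using in_block[OF t] after t e_mono[of m t]
            by (simp add: c_def bump_def)
        qed
      next
        case False
        then show ?thesis using le[of l] e_mono[OF \<open>m \<le> k\<close>] by (auto simp: c_def bump_def)
      qed
      then show "r \<in> c ` {0..k}" using \<open>m \<le> k\<close> by (auto simp: fun_eq_iff)
    qed
  qed
  then show "(s, bump s j ((nx s ^^ k) j) 1) \<in> linear_pairs order k"
    unfolding c0 by (simp add: c_def e_def)
qed

lemma left_pairs_1: "left_pairs 1 = right_pairs 1"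
proof -
  have "{(s, j). s \<in> X \<and> db 1 s j} = {(s, j). s \<in> X \<and> db 1 s j \<and> run s j 1}"
    by (auto simp: run_def drop_before_def)
  then show ?thesis by (simp add: left_pairs_def right_pairs_def)
qed

text \<open>By induction on the number of rotations, adding the last one: \<open>commute\<close> leaves only the two ways of
  prolonging the chain, and switching from one family to the other is impossible.\<close>

lemma linear_chain_cases:
  assumes "(s, t) \<in> cover ^^ Suc m" "total_on (interval order s t) order"
  shows "(s, t) \<in> left_pairs (Suc m) \<union> right_pairs (Suc m)"
  using assms
proof (induction m arbitrary: t)
  case 0
  then obtain j where "s \<in> X" "db 1 s j" "t = raise n s j" by (auto simp: cover_def)
  then show ?case by (auto simp: left_pairs_def raise_def intro!: image_eqI[of _ _ "(s, j)"])
next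
  case (Suc m)
  from Suc.prems(1) obtain x where x: "(s, x) \<in> cover ^^ Suc m" "(x, t) \<in> cover" by auto
  then obtain i where i: "db 1 x i" "t = raise n x i" by (auto simp: cover_def)
  have "(s, x) \<in> cover\<^sup>*" using x(1) relpow_imp_rtrancl by blast
  moreover have s: "s \<in> X" using relpow_Suc_D2[OF x(1)] cover_sub by blast
  ultimately have sx: "(s, x) \<in> order" by (intro rtrancl_cover_order)
  have xt: "(x, t) \<in> order" using x(2) cover_order by blast
  have "interval order s x \<subseteq> interval order s t"
    using xt transD[OF trans_order] unfolding interval_def by blast
  then have "total_on (interval order s x) order"
    using Suc.prems(2) by (rule total_on_subset[rotated])
  from Suc.IH[OF x(1) this] consider "(s, x) \<in> right_pairs (Suc m)"
    | "(s, x) \<in> left_pairs (Suc m)" "0 < m"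
    using left_pairs_1 by (cases "m = 0") auto
  then show ?case
  proof cases
    case 1
    then obtain j where j: "db 1 s j" "run s j (Suc m)" "x = bump s j ((nx s ^^ Suc m) j) 1"
      by (auto simp: right_pairs_def)
    define e where "e t = (nx s ^^ t) j" for t
    define c where "c t = bump s j (e t) 1" for t
    note chain = right_chain[OF s j(1,2), folded e_def, folded c_def]
    have x: "x = c (Suc m)" "x = raise n (c m) (e m)"
      using j chain[of m] by (auto simp: c_def e_def)
    have run: "t \<le> m \<Longrightarrow> e t \<le> n" "t \<le> m \<Longrightarrow> s (e t) = s j" for t
      using j(2) by (auto simp: run_def e_def)
    have e_ge: "j \<le> e t" for t
      by (induction t) (auto simp: e_def intro: order_trans less_imp_le[OF nxt_gt])
    have c_after: "c t l = s l" if "e t \<le> l" for l t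
      using that by (simp add: c_def bump_def)
    have eq: "i = e m \<or> i = nx (c m) (e m) \<and> c m i = c m (e m)"
    proof (rule ccontr)
      assume *: "\<not> ?thesis"
      have "c m \<in> X" using chain[of m] by (auto simp: order_def)
      from commute[OF this chain(3)[of m], of i] i * x
      have "db 1 (c m) i" "(raise n (c m) i, t) \<in> cover\<^sup>*" by auto
      moreover from this have "(raise n (c m) i, t) \<in> order"
        using coverI[OF \<open>c m \<in> X\<close>] cover_sub by (intro rtrancl_cover_order) auto
      ultimately have "e m = i"
        using linear_branch[OF Suc.prems(2) chain(4)[of m] chain(3)[of m]] xt x by auto
      then show False using * by simp
    qed
    show ?thesis
    proof (cases "i = e m")
      case False
      then have i': "i = e (Suc m)" "s i = s (e m)"
        using eq chain(1)[of m] c_after[of m i] c_after[of m "e m"] nxt_gt[of "e m" n s]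
        by (auto simp: e_def)
      then have "nx x i = nx s i"
        unfolding nxt_def using c_after[of "Suc m"] x(1)
        by (intro arg_cong[of _ _ Least]) (auto simp: fun_eq_iff)
      then have "t l = bump s j (e (Suc (Suc m))) 1 l" for l
        using i i' x e_ge[of i] nxt_gt[of i n s] e_ge[of "Suc m"]
        by (simp add: raise_def c_def bump_def e_def)
      then have "t = bump s j (e (Suc (Suc m))) 1" by blast
      moreover have "run s j (Suc (Suc m))"
        using run i' i(1) by (auto simp: run_def e_def[symmetric] drop_before_def less_Suc_eq)
      ultimately show ?thesis
        using s j(1) by (auto simp: right_pairs_def e_def intro!: image_eqI[of _ _ "(s, j)"])
    next
      case True
      have "m = 0"
      proof (rule ccontr)
        assume "m \<noteq> 0"
        then obtain m' where m': "m = Suc m'" using not0_implies_Suc by blast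
        have X: "c m' \<in> X" using chain[of m'] m' by (auto simp: order_def)
        have "raise n (c m') (e m') = c m" "nx (c m') (e m') = e m" using chain[of m'] m' by auto
        moreover have "c m' (e m) = c m' (e m')"
          using c_after[of m'] run[of m] run[of m'] m' nxt_gt[of "e m'" n s] by (auto simp: e_def)
        ultimately have "db 1 (c m') (e m)" "(raise n (c m') (e m), t) \<in> cover"
          using pentagon[OF X chain(3)[of m'], of "e m"] run[of m] i x m' True by auto
        moreover have "(raise n (c m') (e m'), t) \<in> order"
        proof -
          have "c m \<in> X" using chain[of m] by (simp add: order_def)
          then have "(c m, x) \<in> order"
            using coverI[OF _ chain(3)[of m]] x cover_order by simp
          then show ?thesis using chain[of m'] m' xt transD[OF trans_order] by (metis lessI less_SucI)
        qed
        ultimately have "e m' = e m"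
          using linear_branch[OF Suc.prems(2) chain(4)[of m'] chain(3)[of m']] m' cover_order by auto
        then show False using nxt_gt[of "e m'" n s] m' by (simp add: e_def)
      qed
      then have i': "i = j" "x = raise n s j" using True x by (auto simp: e_def c_def)
      have "nx x j = nx s j" by (simp add: i' raise_def nxt_bump)
      then have "t = bump s j (nx s j) 2"
        using i i' by (auto simp: raise_def bump_def fun_eq_iff)
      moreover have "db 2 s j"
        using i i' nxt_gt[of j n s] by (auto simp: drop_before_def raise_def bump_def split: if_splits)
      ultimately show ?thesis using \<open>m = 0\<close> s
        by (auto simp: left_pairs_def numeral_2_eq_2 intro!: image_eqI[of _ _ "(s, j)"])
    qed
  next
    case 2
    then obtain j where j: "db (Suc m) s j" "x = bump s j (nx s j) (int (Suc m))"
      by (auto simp: left_pairs_def)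
    define c where "c t = bump s j (nx s j) (int t)" for t
    note chain = left_chain[OF s j(1), folded c_def]
    have x: "x = c (Suc m)" "x = raise n (c m) j" using chain[of m] j by (auto simp: c_def)
    have eq: "i = j \<or> i = nx (c m) j \<and> c m i = c m j"
    proof (rule ccontr)
      assume *: "\<not> ?thesis"
      have "c m \<in> X" using chain[of m] by (auto simp: order_def)
      from commute[OF this chain(3)[of m], of i] i * x
      have "db 1 (c m) i" "(raise n (c m) i, t) \<in> cover\<^sup>*" by auto
      moreover from this have "(raise n (c m) i, t) \<in> order"
        using coverI[OF \<open>c m \<in> X\<close>] cover_sub by (intro rtrancl_cover_order) auto
      ultimately have "j = i"
        using linear_branch[OF Suc.prems(2) chain(4)[of m] chain(3)[of m]] xt x by auto
      then show False using * by simp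
    qed
    \<comment> \<open>After the first rotation at \<open>j\<close>, the next block starts at a smaller value, so no right step
      can follow.\<close>
    have "i = j"
    proof (rule ccontr)
      assume "i \<noteq> j"
      then have "i = nx s j" "c m i = c m j" using eq chain(1)[of m] by auto
      moreover have "i \<le> n" using i by (simp add: drop_before_def)
      ultimately show False
        using nxt_end[of n s j] nxt_gt[of j n s] \<open>0 < m\<close> by (simp add: c_def bump_def)
    qed
    have "nx x j = nx s j" by (simp add: j(2) nxt_bump)
    then have "t = bump s j (nx s j) (int (Suc (Suc m)))"
      using i \<open>i = j\<close> j(2) by (auto simp: raise_def bump_def fun_eq_iff)
    moreover have "db (Suc (Suc m)) s j"
      using i \<open>i = j\<close> nxt_gt[of j n s] j by (auto simp: drop_before_def bump_def split: if_splits)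
    ultimately show ?thesis using s
      by (auto simp: left_pairs_def intro!: image_eqI[of _ _ "(s, j)"])
  qed
qed

lemma linear_pairs_order:
  assumes "0 < k"
  shows "linear_pairs order k = left_pairs k \<union> right_pairs k"
proof
  show "left_pairs k \<union> right_pairs k \<subseteq> linear_pairs order k"
    using left_pairs_linear right_pairs_linear by simp
  show "linear_pairs order k \<subseteq> left_pairs k \<union> right_pairs k"
  proof
    fix p assume p: "p \<in> linear_pairs order k"
    then obtain s t where st: "p = (s, t)" "(s, t) \<in> order" "total_on (interval order s t) order"
      "height order s t = k"
      by (auto simp: linear_pairs_def)
    then obtain m where m: "(s, t) \<in> cover ^^ m" by (auto simp: order_def rtrancl_power)
    have "m \<noteq> 0"
    proof
      assume "m = 0"
      then have [simp]: "t = s" using m by simp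
      have "(s, s) \<in> linear_pairs order 0"
        using linear_pair_chain[OF antisym_order trans_order, of 0 "\<lambda>_. s"] st(2)
          antisymD[OF antisym_order] by (auto simp: interval_def)
      then show False using st(4) \<open>0 < k\<close> by (simp add: linear_pairs_def)
    qed
    then obtain m' where m': "m = Suc m'" using not0_implies_Suc by blast
    then have *: "(s, t) \<in> left_pairs m \<union> right_pairs m"
      using linear_chain_cases[of s t m'] m st by simp
    then have "(s, t) \<in> linear_pairs order m"
      using left_pairs_linear right_pairs_linear by blast
    then have "m = k" using st(4) by (simp add: linear_pairs_def)
    then show "p \<in> left_pairs k \<union> right_pairs k" using * st by simp
  qed
qed

lemma linear_pairs_order_0: "linear_pairs order 0 = (\<lambda>s. (s, s)) ` X"
proof
  show "(\<lambda>s. (s, s)) ` X \<subseteq> linear_pairs order 0"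
  proof clarify
    fix s assume "s \<in> X"
    then show "(s, s) \<in> linear_pairs order 0"
      using linear_pair_chain[OF antisym_order trans_order, of 0 "\<lambda>_. s"] order_refl
          antisymD[OF antisym_order] by (auto simp: interval_def)
  qed
  show "linear_pairs order 0 \<subseteq> (\<lambda>s. (s, s)) ` X"
  proof
    fix p assume p: "p \<in> linear_pairs order 0"
    then obtain s t where st: "p = (s, t)" "(s, t) \<in> order" "total_on (interval order s t) order"
      "height order s t = 0"
      by (auto simp: linear_pairs_def)
    then obtain m where m: "(s, t) \<in> cover ^^ m" by (auto simp: order_def rtrancl_power)
    have "m = 0"
    proof (rule ccontr)
      assume "m \<noteq> 0"
      then obtain m' where "m = Suc m'" using not0_implies_Suc by blast
      then have "(s, t) \<in> left_pairs (Suc m') \<union> right_pairs (Suc m')"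
        using linear_chain_cases[of s t m'] m st by simp
      then have "(s, t) \<in> linear_pairs order (Suc m')"
        using left_pairs_linear right_pairs_linear by blast
      then show False using st(4) by (simp add: linear_pairs_def)
    qed
    then show "p \<in> (\<lambda>s. (s, s)) ` X" using m st by (auto simp: order_def)
  qed
qed

lemma inj_bumps:
  assumes "\<And>s j. (s, j) \<in> A \<Longrightarrow> j < f s j" and "c > 0"
  shows "inj_on (\<lambda>(s, j). (s, bump s j (f s j) c)) A"
proof (rule inj_onI, clarsimp)
  fix s i j assume *: "(s, i) \<in> A" "(s, j) \<in> A" "bump s i (f s i) c = bump s j (f s j) c"
  then have less: "i < f s i" "j < f s j" using assms by auto
  have "bump s i (f s i) c i = bump s j (f s j) c i" "bump s i (f s i) c j = bump s j (f s j) c j"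
    using * by auto
  then show "i = j" using less \<open>c > 0\<close> by (auto simp: bump_def split: if_splits)
qed

lemma pow_nx_ge: "0 < k \<Longrightarrow> j < (nx s ^^ k) j"
proof (induction k)
  case (Suc k)
  then show ?case using nxt_gt[of j n s] nxt_gt[of "(nx s ^^ k) j" n s]
    by (cases k) (auto intro: less_trans)
qed simp

lemma card_left_pairs:
  assumes "0 < k" shows "card (left_pairs k) = card {(s, j). s \<in> X \<and> db k s j}"
  unfolding left_pairs_def using assms nxt_gt by (intro card_image inj_bumps) auto

lemma card_right_pairs:
  assumes "0 < k" shows "card (right_pairs k) = card {(s, j). s \<in> X \<and> db 1 s j \<and> run s j k}"
  unfolding right_pairs_def using assms pow_nx_ge by (intro card_image inj_bumps) auto

lemma left_right_disjoint:
  assumes "2 \<le> k" shows "left_pairs k \<inter> right_pairs k = {}"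
proof -
  have False if "bump s i (nx s i) (int k) = bump s j ((nx s ^^ k) j) 1" for s i j
  proof -
    have "bump s i (nx s i) (int k) i = bump s j ((nx s ^^ k) j) 1 i" using that by simp
    then show False using assms nxt_gt[of i n s] by (auto simp: bump_def split: if_splits)
  qed
  then show ?thesis by (auto simp: left_pairs_def right_pairs_def)
qed

end

section \<open>Dyck paths as sequences\<close>

abbreviation ups :: "step list \<Rightarrow> nat" where "ups W \<equiv> count_list W U"

text \<open>The values of the prefixes before each up step, for a word whose first up step has index \<open>i\<close> and
  which starts at value \<open>c\<close>.\<close>

fun heights :: "(nat \<Rightarrow> int) \<Rightarrow> nat \<Rightarrow> int \<Rightarrow> step list \<Rightarrow> int list" where
  "heights \<delta> i c [] = []"
| "heights \<delta> i c (U # W) = c # heights \<delta> (Suc i) (c + \<delta> i) W"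
| "heights \<delta> i c (D # W) = heights \<delta> i (c - 1) W"

text \<open>The value of a word whose first up step has index \<open>i\<close>.\<close>

fun val :: "(nat \<Rightarrow> int) \<Rightarrow> nat \<Rightarrow> step list \<Rightarrow> int" where
  "val \<delta> i [] = 0"
| "val \<delta> i (U # W) = \<delta> i + val \<delta> (Suc i) W"
| "val \<delta> i (D # W) = val \<delta> i W - 1"

text \<open>The words that lead from height \<open>h\<close> to height \<open>0\<close> without passing below \<open>0\<close>, where an up step
  always counts \<open>1\<close>.\<close>

fun path_from :: "nat \<Rightarrow> step list \<Rightarrow> bool" where
  "path_from h [] \<longleftrightarrow> h = 0"
| "path_from h (U # W) \<longleftrightarrow> path_from (Suc h) W"
| "path_from h (D # W) \<longleftrightarrow> 0 < h \<and> path_from (h - 1) W"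

lemma ups_append [simp]: "ups (V @ W) = ups V + ups W"
  by (induction V) auto

lemma val_append: "val \<delta> i (V @ W) = val \<delta> i V + val \<delta> (i + ups V) W"
  by (induction \<delta> i V rule: val.induct) auto

lemma heights_append:
  "heights \<delta> i c (V @ W) = heights \<delta> i c V @ heights \<delta> (i + ups V) (c + val \<delta> i V) W"
  by (induction \<delta> i c V rule: heights.induct) (auto simp: algebra_simps)

lemma length_heights [simp]: "length (heights \<delta> i c W) = ups W"
  by (induction \<delta> i c W rule: heights.induct) auto

lemma heights_shift: "heights \<delta> i (c + e) W = map (\<lambda>x. x + e) (heights \<delta> i c W)"
proof (induction \<delta> i c W rule: heights.induct)
  case (3 \<delta> i c W)
  then show ?case by (simp add: algebra_simps)
next
  case (2 \<delta> i c W)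
  then show ?case by (simp add: algebra_simps)
qed simp

lemma hd_heights: "heights \<delta> i c W = x # xs \<Longrightarrow> x \<le> c"
  by (induction \<delta> i c W arbitrary: xs rule: heights.induct) fastforce+

lemma val_le:
  assumes "\<And>i. \<delta> i \<le> 1" shows "path_from h W \<Longrightarrow> val \<delta> i W \<le> - int h"
proof (induction h W arbitrary: i rule: path_from.induct)
  case (2 h W)
  then have "val \<delta> (Suc i) W \<le> - int (Suc h)" by simp
  then show ?case using assms[of i] by simp
next
  case (3 h W)
  then show ?case using "3.IH"[of i] by (cases h) auto
qed simp

lemma path_from_append: "path_from h (V @ W) \<Longrightarrow> \<exists>h'. path_from h' W"
  by (induction h V rule: path_from.induct) auto

lemma path_from_move_down: "path_from h (C @ B) \<Longrightarrow> path_from (Suc h) (C @ D # B)"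
proof (induction h C rule: path_from.induct)
  case (3 h W)
  then show ?case by (cases h) auto
qed auto

lemma path_from_rotate: "path_from h (A @ D # C @ B) \<Longrightarrow> path_from h (A @ C @ D # B)"
proof (induction h A rule: path_from.induct)
  case (1 h)
  then show ?case using path_from_move_down[of "h - 1" C B] by simp
qed auto

lemma path_from_iff:
  "path_from h P \<longleftrightarrow> count_list P D = h + count_list P U \<and>
     (\<forall>m\<le>length P. count_list (take m P) D \<le> h + count_list (take m P) U)"
proof (induction P arbitrary: h)
  case (Cons x P)
  have split: "(\<forall>m\<le>Suc k. Q m) \<longleftrightarrow> Q 0 \<and> (\<forall>m\<le>k. Q (Suc m))" for Q and k :: nat
    by (metis Suc_le_mono not0_implies_Suc zero_le)
  show ?case
  proof (cases x)
    case U
    then show ?thesis using Cons by (simp add: split)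
  next
    case D
    show ?thesis
    proof (cases h)
      case 0
      then show ?thesis using D by (auto simp: split)
    next
      case (Suc h')
      then show ?thesis using Cons[of h'] D by (simp add: split)
    qed
  qed
qed auto

lemma dyck_paths_eq: "dyck_paths n = {P. path_from 0 P \<and> ups P = n}"
  unfolding dyck_paths_def path_from_iff by auto

lemma heights_inj:
  assumes "path_from h P" "path_from h Q" "heights \<delta> i c P = heights \<delta> i c Q"
  shows "P = Q"
  using assms
proof (induction P arbitrary: h i c Q)
  case Nil
  then have "h = 0" "ups Q = 0" by (auto dest: arg_cong[of _ _ length])
  then show ?case using Nil by (cases Q; cases "hd Q") auto
next
  case (Cons x P)
  then obtain y R where Q: "Q = y # R" by (cases Q) (cases x; auto)+
  show ?case
  proof (cases "x = y")
    case True
    then show ?thesis using Cons Q by (cases x) auto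
  next
    case False
    then have "x = U \<and> y = D \<or> x = D \<and> y = U" by (cases x; cases y) auto
    then show ?thesis
    proof
      assume *: "x = U \<and> y = D"
      then have "heights \<delta> i (c - 1) R = c # heights \<delta> (Suc i) (c + \<delta> i) P"
        using Cons.prems(3) Q by simp
      from hd_heights[OF this] show ?thesis by simp
    next
      assume *: "x = D \<and> y = U"
      then have "heights \<delta> i (c - 1) P = c # heights \<delta> (Suc i) (c + \<delta> i) R"
        using Cons.prems(3) Q by simp
      from hd_heights[OF this] show ?thesis by simp
    qed
  qed
qed

text \<open>The sequence of a Dyck path, indexed from \<open>1\<close>, with default value \<open>0\<close> elsewhere.\<close>

definition vec :: "(nat \<Rightarrow> int) \<Rightarrow> step list \<Rightarrow> nat \<Rightarrow> int" where
  "vec \<delta> P l = (if 1 \<le> l \<and> l \<le> ups P then heights \<delta> 1 0 P ! (l - 1) else 0)"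

lemma inj_vec: "inj_on (vec \<delta>) (dyck_paths n)"
proof (rule inj_onI)
  fix P Q assume P: "P \<in> dyck_paths n" and Q: "Q \<in> dyck_paths n" and eq: "vec \<delta> P = vec \<delta> Q"
  have "heights \<delta> 1 0 P = heights \<delta> 1 0 Q"
  proof (rule nth_equalityI)
    show "length (heights \<delta> 1 0 P) = length (heights \<delta> 1 0 Q)"
      using P Q by (simp add: dyck_paths_eq)
    fix l assume "l < length (heights \<delta> 1 0 P)"
    then show "heights \<delta> 1 0 P ! l = heights \<delta> 1 0 Q ! l"
      using fun_cong[OF eq, of "Suc l"] P Q by (simp add: vec_def dyck_paths_eq)
  qed
  then show "P = Q" using heights_inj P Q by (auto simp: dyck_paths_eq)
qed

lemma vec_at: "vec \<delta> (A @ U # W) (Suc (ups A)) = val \<delta> 1 A"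
  by (simp add: vec_def heights_append nth_append)

lemma ex_up:
  assumes "j < ups P" shows "\<exists>A W. P = A @ U # W \<and> ups A = j"
  using assms
proof (induction P arbitrary: j)
  case (Cons x P)
  show ?case
  proof (cases "x = U \<and> j = 0")
    case True
    then have "x # P = [] @ U # P \<and> ups [] = j" by simp
    then show ?thesis by blast
  next
    case False
    define j' where "j' = (if x = U then j - 1 else j)"
    have "j' < ups P" using Cons.prems False by (auto simp: j'_def split: if_splits)
    from Cons.IH[OF this] obtain A W where "P = A @ U # W" "ups A = j'" by blast
    then have "x # P = (x # A) @ U # W \<and> ups (x # A) = j" using False by (auto simp: j'_def)
    then show ?thesis by blast
  qed
qed simp

lemma up_unique:
  "A @ U # W = A' @ U # W' \<Longrightarrow> ups A = ups A' \<Longrightarrow> A = A' \<and> W = W'"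
proof (induction A arbitrary: A')
  case Nil
  then show ?case by (cases A') auto
next
  case (Cons x A)
  then show ?case by (cases A') (auto split: if_splits)
qed

lemma last_up:
  assumes "0 < ups A" obtains A1 p where "A = A1 @ U # replicate p D"
proof -
  have "U \<in> set A" using assms by (metis count_list_0_iff less_irrefl)
  then obtain A1 zs where "A = A1 @ U # zs" "U \<notin> set zs" by (meson split_list_last)
  moreover from this have "zs = replicate (length zs) D" by (metis replicate_eqI step.exhaust)
  ultimately show thesis using that by metis
qed

lemma replicate_D [simp]: "val \<delta> i (replicate p D) = - int p" "ups (replicate p D) = 0"
  by (induction p) auto

lemma vec_step:
  fixes A1 p defines "A \<equiv> A1 @ U # replicate p D"
  shows "vec \<delta> (A @ U # W) (Suc (ups A)) =
    vec \<delta> (A @ U # W) (ups A) + \<delta> (ups A) - int p"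
proof -
  have "vec \<delta> (A @ U # W) (ups A) = val \<delta> 1 A1"
    using vec_at[of \<delta> A1 "replicate p D @ U # W"] by (simp add: A_def)
  then show ?thesis unfolding vec_at by (simp add: A_def val_append)
qed

lemma drop_before_iff:
  assumes P: "A @ U # W \<in> dyck_paths n" and "1 \<le> k"
  shows "drop_before n \<delta> k (vec \<delta> (A @ U # W)) (Suc (ups A)) \<longleftrightarrow> (\<exists>A'. A = A' @ replicate k D)"
proof (cases "0 < ups A")
  case False
  then have A: "A = replicate (length A) D"
    by (metis count_list_0_iff neq0_conv replicate_eqI step.exhaust)
  have "A = []"
  proof (rule ccontr)
    assume "A \<noteq> []"
    then obtain A' where "A = D # A'" using A by (cases "length A") auto
    then show False using P by (simp add: dyck_paths_eq)
  qed
  then show ?thesis using \<open>1 \<le> k\<close> by (simp add: drop_before_def)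
next
  case True
  from last_up[OF this] obtain A1 p where A: "A = A1 @ U # replicate p D" .
  have "Suc (ups A) \<le> n" using P by (simp add: dyck_paths_eq)
  then have "drop_before n \<delta> k (vec \<delta> (A @ U # W)) (Suc (ups A)) \<longleftrightarrow> k \<le> p"
    using vec_step[of \<delta> A1 p W, folded A] True by (auto simp: drop_before_def)
  also have "\<dots> \<longleftrightarrow> (\<exists>A'. A = A' @ replicate k D)"
  proof
    assume "k \<le> p"
    then have "A = (A1 @ U # replicate (p - k) D) @ replicate k D"
      by (simp add: A replicate_add[symmetric])
    then show "\<exists>A'. A = A' @ replicate k D" by blast
  next
    assume "\<exists>A'. A = A' @ replicate k D"
    then obtain A' where "rev (A' @ replicate k D) = rev A" by auto
    then have "(replicate k D @ rev A') ! p = (replicate p D @ U # rev A1) ! p"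
      by (simp add: A)
    then show "k \<le> p" by (auto simp: nth_append split: if_splits)
  qed
  finally show ?thesis .
qed

section \<open>Excursions and rotations\<close>

text \<open>The condition of \<open>is_excursion\<close> on the letters of the excursion, with the index of its first up
  step as the only trace of its position.\<close>

definition excursion :: "(nat \<Rightarrow> int) \<Rightarrow> nat \<Rightarrow> step list \<Rightarrow> bool" where
  "excursion \<delta> i C \<longleftrightarrow> C \<noteq> [] \<and> hd C = U \<and> val \<delta> i C = 0 \<and>
     (\<forall>m. 0 < m \<and> m < length C \<longrightarrow> val \<delta> i (take m C) \<noteq> 0)"

lemma subword_value_eq:
  "subword_value \<delta> (A @ C @ B) (length A) (length C) = val \<delta> (Suc (ups A)) C"
proof (induction C arbitrary: A)
  case Nil
  then show ?case by (simp add: subword_value_def)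
next
  case (Cons x C)
  have "{length A..<length A + length (x # C)} =
      insert (length A) {length (A @ [x])..<length (A @ [x]) + length C}"
    by auto
  then have "subword_value \<delta> (A @ (x # C) @ B) (length A) (length (x # C)) =
      step_value \<delta> (A @ (x # C) @ B) (length A)
      + subword_value \<delta> ((A @ [x]) @ C @ B) (length (A @ [x])) (length C)"
    by (simp add: subword_value_def)
  also have "\<dots> = val \<delta> (Suc (ups A)) (x # C)"
    unfolding Cons.IH by (cases x) (simp_all add: step_value_def nth_append)
  finally show ?case .
qed

lemma is_excursion_iff:
  "is_excursion \<delta> (A @ C @ B) (length A) (length C) \<longleftrightarrow> excursion \<delta> (Suc (ups A)) C"
proof -
  have take: "subword_value \<delta> (A @ C @ B) (length A) m = val \<delta> (Suc (ups A)) (take m C)"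
    if "m \<le> length C" for m
    using subword_value_eq[of \<delta> A "take m C" "drop m C @ B"] that
    by (metis append_assoc append_take_drop_id length_take min_absorb2)
  have "C \<noteq> [] \<Longrightarrow> (A @ C @ B) ! length A = hd C"
    by (simp add: nth_append hd_conv_nth)
  then show ?thesis
    unfolding is_excursion_def excursion_def using take by (auto simp: less_imp_le)
qed

text \<open>Down steps decrease the value by exactly \<open>1\<close>, so it cannot become negative without passing
  through \<open>0\<close>.\<close>

lemma excursion_inside:
  assumes "excursion \<delta> i C" "\<And>i. 0 \<le> \<delta> i" "0 < m" "m < length C"
  shows "0 < val \<delta> i (take m C)"
  using assms(3,4)
proof (induction m)
  case (Suc m)
  have "0 \<le> val \<delta> i (take (Suc m) C)"
  proof (cases "m = 0")
    case True
    then show ?thesis using assms(1,2) Suc.prems by (cases C) (auto simp: excursion_def)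
  next
    case False
    then have "1 \<le> val \<delta> i (take m C)" using Suc by simp
    moreover have "- 1 \<le> val \<delta> j [x]" for j x using assms(2)[of j] by (cases x) auto
    ultimately show ?thesis using Suc.prems
      by (simp add: take_Suc_conv_app_nth val_append) (smt (verit))
  qed
  moreover have "val \<delta> i (take (Suc m) C) \<noteq> 0" using assms(1) Suc.prems by (simp add: excursion_def)
  ultimately show ?case by simp
qed simp

lemma in_heights:
  "x \<in> set (heights \<delta> i c W) \<Longrightarrow> \<exists>m<length W. x = c + val \<delta> i (take m W)"
proof (induction \<delta> i c W rule: heights.induct)
  case (2 \<delta> i c W)
  show ?case
  proof (cases "x = c")
    case True
    then show ?thesis by (intro exI[of _ 0]) simp
  next
    case False
    then obtain m where "m < length W" "x = c + \<delta> i + val \<delta> (Suc i) (take m W)"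
      using 2 by auto
    then show ?thesis by (intro exI[of _ "Suc m"]) simp
  qed
next
  case (3 \<delta> i c W)
  then obtain m where "m < length W" "x = c - 1 + val \<delta> i (take m W)" by auto
  then show ?case by (intro exI[of _ "Suc m"]) simp
qed simp

lemma heights_excursion:
  assumes "excursion \<delta> i C" "\<And>i. 0 \<le> \<delta> i"
  obtains xs where "heights \<delta> i c C = c # xs" "\<And>x. x \<in> set xs \<Longrightarrow> c < x"
proof -
  obtain C' where C: "C = U # C'" using assms(1) by (cases C) (auto simp: excursion_def)
  have "c < x" if x: "x \<in> set (heights \<delta> (Suc i) (c + \<delta> i) C')" for x
  proof -
    from in_heights[OF x] obtain m where
      "m < length C'" "x = c + \<delta> i + val \<delta> (Suc i) (take m C')" by blast
    then show ?thesis using excursion_inside[OF assms, of "Suc m"] by (simp add: C)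
  qed
  then show thesis using that by (simp add: C)
qed

text \<open>Stop at the first moment when the value is \<open>- c\<close>.\<close>

lemma first_descent:
  assumes "\<And>i. 0 \<le> \<delta> i" "val \<delta> i W \<le> - int c"
  shows "\<exists>C B. W = C @ B \<and> val \<delta> i C = - int c \<and> (\<forall>m<length C. - int c < val \<delta> i (take m C))"
  using assms(2)
proof (induction W arbitrary: i c)
  case Nil
  then show ?case by simp
next
  case (Cons x W)
  show ?case
  proof (cases "c = 0")
    case True
    then show ?thesis by (intro exI[of _ "[]"] exI[of _ "x # W"]) simp
  next
    case False
    define i' where "i' = (if x = U then Suc i else i)"
    define c' where "c' = (if x = U then c + nat (\<delta> i) else c - 1)"
    have step: "val \<delta> i (x # V) = val \<delta> i' V + int c' - int c" for V
      using False assms(1)[of i] by (cases x) (auto simp: i'_def c'_def)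
    then have "val \<delta> i' W \<le> - int c'" using Cons.prems by simp
    from Cons.IH[OF this] obtain C B where CB: "W = C @ B" "val \<delta> i' C = - int c'"
      "\<And>m. m < length C \<Longrightarrow> - int c' < val \<delta> i' (take m C)" by blast
    have "- int c < val \<delta> i (take m (x # C))" if "m < length (x # C)" for m
      using that CB(3)[of "m - 1"] step False by (cases m) auto
    then have "x # W = (x # C) @ B \<and> val \<delta> i (x # C) = - int c \<and>
      (\<forall>m<length (x # C). - int c < val \<delta> i (take m (x # C)))"
      using CB step by simp
    then show ?thesis by blast
  qed
qed

text \<open>The value of a word is at most its gain in height, which is not positive on the rest of a Dyck
  path, so the value returns to \<open>0\<close> after the up step.\<close>

lemma ex_excursion:
  assumes "\<And>i. 0 \<le> \<delta> i" "\<And>i. \<delta> i \<le> 1" "path_from h (U # W)"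
  shows "\<exists>C B. U # W = C @ B \<and> excursion \<delta> i C"
proof -
  have "val \<delta> i (U # W) \<le> - int h" using val_le assms(2,3) by blast
  then have "val \<delta> (Suc i) W \<le> - int (nat (\<delta> i))" using assms(1)[of i] by simp
  from first_descent[of \<delta>, OF assms(1) this] obtain C B where
    CB: "W = C @ B" "val \<delta> (Suc i) C = - int (nat (\<delta> i))"
      "\<And>m. m < length C \<Longrightarrow> - int (nat (\<delta> i)) < val \<delta> (Suc i) (take m C)" by blast
  have "val \<delta> i (take m (U # C)) \<noteq> 0" if "0 < m" "m < length (U # C)" for m
    using that CB(3)[of "m - 1"] assms(1)[of i] by (cases m) auto
  then have "excursion \<delta> i (U # C)"
    using CB(2) assms(1)[of i] by (simp add: excursion_def)
  then show ?thesis using CB(1) by (intro exI[of _ "U # C"] exI[of _ B]) simp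
qed

text \<open>Moving the down step behind the excursion raises the value before each up step in the excursion
  by \<open>1\<close> and changes no other one.\<close>

lemma vec_rotate:
  assumes nonneg: "\<And>i. 0 \<le> \<delta> i"
    and P: "A @ D # C @ B \<in> dyck_paths n" and exc: "excursion \<delta> (Suc (ups A)) C"
  defines "s \<equiv> vec \<delta> (A @ D # C @ B)" and "j \<equiv> Suc (ups A)"
  shows "A @ C @ D # B \<in> dyck_paths n"
    and "drop_before n \<delta> 1 s j"
    and "vec \<delta> (A @ C @ D # B) = raise n s j"
proof -
  show Q: "A @ C @ D # B \<in> dyck_paths n"
    using P path_from_rotate by (simp add: dyck_paths_eq)
  obtain C' where C: "C = U # C'" using exc by (cases C) (auto simp: excursion_def)
  show "drop_before n \<delta> 1 s j"
    using drop_before_iff[of "A @ [D]" "C' @ B" n 1 \<delta>] P by (simp add: s_def j_def C)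
  define HA where "HA = heights \<delta> 1 0 A"
  have j1: "1 + ups A = j" by (simp add: j_def)
  define HB where "HB = heights \<delta> (j + ups C) (val \<delta> 1 A - 1) B"
  obtain xs where HC: "heights \<delta> j (val \<delta> 1 A - 1) C = (val \<delta> 1 A - 1) # xs"
    and xs: "\<And>x. x \<in> set xs \<Longrightarrow> val \<delta> 1 A - 1 < x"
    using heights_excursion[OF exc nonneg, of "val \<delta> 1 A - 1"] j_def by metis
  define y where "y = val \<delta> 1 A - 1"
  have val0: "val \<delta> j C = 0" using exc by (simp add: excursion_def j_def)
  have n: "n = ups A + ups C + ups B" using P by (simp add: dyck_paths_eq)
  have len: "length HA = ups A" "length (y # xs) = ups C" "length HB = ups B"
    unfolding HA_def HB_def y_def HC[symmetric] by simp_all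
  have HP: "heights \<delta> 1 0 (A @ D # C @ B) = HA @ (y # xs) @ HB"
    by (simp add: heights_append val0 HA_def HB_def j1 HC y_def del: One_nat_def)
  have "heights \<delta> j (val \<delta> 1 A) C = map (\<lambda>x. x + 1) (y # xs)"
    using heights_shift[of \<delta> j "val \<delta> 1 A - 1" 1 C] HC by (simp add: y_def)
  then have HQ: "heights \<delta> 1 0 (A @ C @ D # B) = HA @ map (\<lambda>x. x + 1) (y # xs) @ HB"
    by (simp add: heights_append val0 HA_def HB_def j1 del: One_nat_def)
  note HP = HP[unfolded One_nat_def] and HQ = HQ[unfolded One_nat_def]
  have sA: "s l = (HA @ (y # xs) @ HB) ! (l - 1)" if "1 \<le> l" "l \<le> n" for l
    using that n by (simp add: s_def vec_def HP)
  have sC: "s (j + l) = (y # xs) ! l" if "l < ups C" for l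
    using that sA[of "j + l"] len n nth_append[of "y # xs" HB l]
    by (simp add: j_def nth_append[of HA])
  have nxt: "nxt n s j = j + ups C"
  proof (rule nxt_eqI)
    show "j < j + ups C" by (simp add: C)
    fix l assume l: "j < l" "l < j + ups C"
    then obtain l' where l': "l = j + Suc l'" using less_imp_Suc_add by auto
    then have "xs ! l' \<in> set xs" using l len by simp
    then show "l \<le> n \<and> s j < s l"
      using sC[of 0] sC[of "Suc l'"] l l' n xs by (auto simp: y_def j_def C)
  next
    show "n < j + ups C \<or> s (j + ups C) \<le> s j"
    proof (cases "HB")
      case Nil
      then show ?thesis using len n by (simp add: j_def)
    next
      case (Cons z zs)
      then have "z \<le> y" using hd_heights[of \<delta> _ y B z zs] by (simp add: HB_def y_def)
      moreover have "s (j + ups C) = z"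
      proof -
        have "s (j + ups C) = ((HA @ y # xs) @ HB) ! (length (HA @ y # xs) + 0)"
          using sA[of "j + ups C"] len n Cons by (simp add: j_def)
        then show ?thesis unfolding nth_append_length_plus by (simp add: Cons)
      qed
      ultimately show ?thesis using sC[of 0] by (simp add: C)
    qed
  qed
  show "vec \<delta> (A @ C @ D # B) = raise n s j"
  proof
    fix l
    consider "l < 1 \<or> n < l" | "1 \<le> l" "l < j" | l' where "l = j + l'" "l' < ups C"
      | "j + ups C \<le> l" "l \<le> n"
      by (metis le_add_diff_inverse linorder_not_less nat_add_left_cancel_less)
    then show "vec \<delta> (A @ C @ D # B) l = raise n s j l"
    proof cases
      case 1
      then show ?thesis using n unfolding raise_def nxt by (auto simp: bump_def s_def vec_def j_def)
    next
      case 2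
      then show ?thesis using n len unfolding raise_def nxt
        by (auto simp: bump_def sA vec_def j_def HQ nth_append)
    next
      case 3
      then have "vec \<delta> (A @ C @ D # B) l = (HA @ map (\<lambda>x. x + 1) (y # xs) @ HB) ! (ups A + l')"
        using n by (simp add: vec_def HQ j_def)
      also have "\<dots> = map (\<lambda>x. x + 1) (y # xs) ! l'"
        using len 3 by (simp add: nth_append del: list.map)
      also have "\<dots> = (y # xs) ! l' + 1"
        using len 3 by (subst nth_map) auto
      finally show ?thesis using 3 sC[of l'] unfolding raise_def nxt by (simp add: bump_def)
    next
      case 4
      then have "vec \<delta> (A @ C @ D # B) l = (HA @ map (\<lambda>x. x + 1) (y # xs) @ HB) ! (l - 1)"
        using n by (simp add: vec_def HQ j_def)
      also have "\<dots> = (HA @ (y # xs) @ HB) ! (l - 1)"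
      proof -
        define l' where "l' = l - (j + ups C)"
        have "(Vs @ HB) ! (l - 1) = HB ! l'" if "length Vs = ups A + ups C" for Vs
          using nth_append_length_plus[of Vs HB l'] that 4 by (simp add: l'_def j_def)
        from this[of "HA @ y # xs"] this[of "HA @ map (\<lambda>x. x + 1) (y # xs)"]
        show ?thesis using len by simp
      qed
      also have "\<dots> = s l" using sA[of l] 4 by (simp add: j_def)
      finally show ?thesis using 4 unfolding raise_def nxt by (simp add: bump_def)
    qed
  qed
qed

lemma rotation_vec:
  assumes "\<And>i. 0 \<le> \<delta> i" "P \<in> dyck_paths n" "(P, Q) \<in> rotation \<delta>"
  shows "\<exists>j. drop_before n \<delta> 1 (vec \<delta> P) j \<and> vec \<delta> Q = raise n (vec \<delta> P) j \<and> Q \<in> dyck_paths n"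
proof -
  from assms(3) obtain A B C where ABC: "P = A @ D # C @ B" "Q = A @ C @ D # B"
    "is_excursion \<delta> (A @ [D] @ C @ B) (Suc (length A)) (length C)"
    by (auto simp: rotation_def)
  then have "excursion \<delta> (Suc (ups A)) C"
    using is_excursion_iff[of \<delta> "A @ [D]" C B] by simp
  then show ?thesis using vec_rotate[of \<delta> A C B n] assms ABC by blast
qed

lemma rotation_exists:
  assumes "\<And>i. 0 \<le> \<delta> i" "\<And>i. \<delta> i \<le> 1" and P: "P \<in> dyck_paths n"
    and j: "drop_before n \<delta> 1 (vec \<delta> P) j"
  shows "\<exists>Q. (P, Q) \<in> rotation \<delta> \<and> Q \<in> dyck_paths n \<and> vec \<delta> Q = raise n (vec \<delta> P) j"
proof -
  have "j - 1 < ups P" "1 < j" using P j by (auto simp: dyck_paths_eq drop_before_def)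
  with ex_up obtain A0 W where A0: "P = A0 @ U # W" "Suc (ups A0) = j"
    by (metis Suc_diff_1 less_trans zero_less_one)
  then obtain A where A: "A0 = A @ [D]" using drop_before_iff[of A0 W n 1 \<delta>] P j by auto
  have "path_from 0 (A0 @ U # W)" using P A0 by (simp add: dyck_paths_eq)
  then obtain h where "path_from h (U # W)" using path_from_append by blast
  then have "\<exists>C B. U # W = C @ B \<and> excursion \<delta> j C"
    by (rule ex_excursion[of \<delta>, OF assms(1,2)])
  then obtain C B where C: "U # W = C @ B" "excursion \<delta> j C" by blast
  have P': "P = A @ D # C @ B" using A0 A C by simp
  have "Suc (ups A) = j" using A0 A by simp
  then have "is_excursion \<delta> (A @ [D] @ C @ B) (Suc (length A)) (length C)"
    using is_excursion_iff[of \<delta> "A @ [D]" C B] C by simp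
  then have "(P, A @ C @ [D] @ B) \<in> rotation \<delta>"
    unfolding rotation_def P' by (intro CollectI exI[of _ A] exI[of _ B] exI[of _ C]) simp
  then show ?thesis
    using vec_rotate[of \<delta> A C B n] assms(1) P P' C(2) \<open>Suc (ups A) = j\<close> by auto
qed

lemma rise_vectors_dyck:
  assumes "\<And>i. 0 \<le> \<delta> i" "\<And>i. \<delta> i \<le> 1"
  shows "rise_vectors n \<delta> (vec \<delta> ` dyck_paths n)"
proof
  fix l show "0 \<le> \<delta> l" by (rule assms(1))
next
  fix s l assume s: "s \<in> vec \<delta> ` dyck_paths n" and l: "1 < l" "l \<le> n"
  then obtain P where P: "P \<in> dyck_paths n" "s = vec \<delta> P" by auto
  then have "l - 1 < ups P" using l by (simp add: dyck_paths_eq)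
  with ex_up obtain A W where A: "P = A @ U # W" "ups A = l - 1" by blast
  then obtain A1 p where "A = A1 @ U # replicate p D" using last_up[of A] l by auto
  then have "vec \<delta> P (Suc (ups A)) \<le> vec \<delta> P (ups A) + \<delta> (ups A)"
    using vec_step[of \<delta> A1 p W] A(1) by simp
  then show "s l \<le> s (l - 1) + \<delta> (l - 1)" using A(2) P(2) l by simp
next
  fix s j assume "s \<in> vec \<delta> ` dyck_paths n" "drop_before n \<delta> 1 s j"
  then show "raise n s j \<in> vec \<delta> ` dyck_paths n"
    using rotation_exists[of \<delta> _ n j] assms by (metis imageE image_eqI)
qed

text \<open>The alt-Tamari poset is isomorphic to the order on sequences.\<close>

lemma order_alt_tamari:
  assumes "\<And>i. 0 \<le> \<delta> i" "\<And>i. \<delta> i \<le> 1"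
  shows "map_prod (vec \<delta>) (vec \<delta>) ` alt_tamari n \<delta> =
    rise_vectors.order n \<delta> (vec \<delta> ` dyck_paths n)"
proof -
  let ?X = "vec \<delta> ` dyck_paths n"
  let ?r = "Restr (rotation \<delta>) (dyck_paths n)"
  interpret rise_vectors n \<delta> ?X using rise_vectors_dyck[of \<delta>] assms by blast
  have 1: "(vec \<delta> P, vec \<delta> Q) \<in> cover\<^sup>*" if "(P, Q) \<in> ?r\<^sup>*" for P Q
    using that
  proof (induction rule: rtrancl_induct)
    case (step Q R)
    then obtain j where "drop_before n \<delta> 1 (vec \<delta> Q) j" "vec \<delta> R = raise n (vec \<delta> Q) j"
      using rotation_vec[of \<delta> Q n R] assms(1) by auto
    then have "(vec \<delta> Q, vec \<delta> R) \<in> cover" using coverI[of "vec \<delta> Q" j] step by auto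
    then show ?case using step.IH by simp
  qed simp
  have 2: "\<exists>Q\<in>dyck_paths n. t = vec \<delta> Q \<and> (P, Q) \<in> ?r\<^sup>*"
    if "(vec \<delta> P, t) \<in> cover\<^sup>*" "P \<in> dyck_paths n" for P t
    using that(1)
  proof (induction rule: rtrancl_induct)
    case base
    then show ?case using that by blast
  next
    case (step t u)
    then obtain Q where Q: "Q \<in> dyck_paths n" "t = vec \<delta> Q" "(P, Q) \<in> ?r\<^sup>*" by blast
    from step(2) obtain j where "drop_before n \<delta> 1 t j" "u = raise n t j"
      by (auto simp: cover_def)
    then obtain R where "(Q, R) \<in> rotation \<delta>" "R \<in> dyck_paths n" "vec \<delta> R = u"
      using rotation_exists[of \<delta> Q n j] assms Q by auto
    moreover from this have "(P, R) \<in> ?r\<^sup>*"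
      using Q by (meson IntI SigmaI rtrancl.rtrancl_into_rtrancl)
    ultimately show ?case by blast
  qed
  show ?thesis
  proof (intro set_eqI iffI)
    fix z assume "z \<in> map_prod (vec \<delta>) (vec \<delta>) ` alt_tamari n \<delta>"
    then show "z \<in> order" using 1 unfolding alt_tamari_def order_def by auto
  next
    fix z assume "z \<in> order"
    then obtain P t where "z = (vec \<delta> P, t)" "P \<in> dyck_paths n" "(vec \<delta> P, t) \<in> cover\<^sup>*"
      unfolding order_def by auto
    with 2 obtain Q where "z = map_prod (vec \<delta>) (vec \<delta>) (P, Q)" "(P, Q) \<in> alt_tamari n \<delta>"
      unfolding alt_tamari_def by (metis IntI SigmaI map_prod_simp)
    then show "z \<in> map_prod (vec \<delta>) (vec \<delta>) ` alt_tamari n \<delta>" by (rule image_eqI)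
  qed
qed

lemma card_linear_intervals_alt_tamari:
  assumes "\<And>i. 0 \<le> \<delta> i" "\<And>i. \<delta> i \<le> 1"
  shows "card (linear_intervals (alt_tamari n \<delta>) k) =
    card (linear_pairs (rise_vectors.order n \<delta> (vec \<delta> ` dyck_paths n)) k)"
proof -
  interpret rise_vectors n \<delta> "vec \<delta> ` dyck_paths n" using rise_vectors_dyck[of \<delta>] assms by blast
  let ?r = "alt_tamari n \<delta>" and ?f = "map_prod (vec \<delta>) (vec \<delta>)"
  have sub: "?r \<subseteq> dyck_paths n \<times> dyck_paths n" by (auto simp: alt_tamari_def)
  have img: "?f ` ?r = order" using order_alt_tamari[of \<delta> n] assms by blast
  have "antisym ?r"
  proof (rule antisymI)
    fix P Q assume *: "(P, Q) \<in> ?r" "(Q, P) \<in> ?r"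
    then have "?f (P, Q) \<in> order" "?f (Q, P) \<in> order" unfolding img[symmetric] by blast+
    then have "vec \<delta> P = vec \<delta> Q" using antisymD[OF antisym_order] by simp
    then show "P = Q" using inj_onD[OF inj_vec] * sub by blast
  qed
  then have "card (linear_intervals ?r k) = card (linear_pairs ?r k)"
    by (rule card_linear_intervals) (auto simp: alt_tamari_def)
  also have "\<dots> = card (?f ` linear_pairs ?r k)"
  proof (rule card_image[symmetric], rule inj_on_subset)
    show "inj_on ?f (dyck_paths n \<times> dyck_paths n)" using inj_vec by (intro map_prod_inj_on)
    show "linear_pairs ?r k \<subseteq> dyck_paths n \<times> dyck_paths n" using sub by (auto simp: linear_pairs_def)
  qed
  also have "?f ` linear_pairs ?r k = linear_pairs order k"
    using linear_pairs_map_prod[OF inj_vec[of \<delta> n] sub, of k] img by simp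
  finally show ?thesis .
qed

section \<open>Successive excursions\<close>

text \<open>The first \<open>k\<close> entries of the list that are at most \<open>c\<close> exist and are all equal to \<open>c\<close>. For the list
  of values at the up steps of a word, this says that \<open>k\<close> successive excursions follow the
  first arrival at the value \<open>c\<close>.\<close>

fun starts :: "int \<Rightarrow> nat \<Rightarrow> int list \<Rightarrow> bool" where
  "starts c 0 xs \<longleftrightarrow> True"
| "starts c (Suc k) [] \<longleftrightarrow> False"
| "starts c (Suc k) (x # xs) \<longleftrightarrow> (if c < x then starts c (Suc k) xs else x = c \<and> starts c k xs)"

lemma starts_skip:
  assumes "a \<le> m" "\<And>l. a \<le> l \<Longrightarrow> l < m \<Longrightarrow> c < s l" "m \<le> Suc n"
  shows "starts c k (map s [a..<Suc n]) \<longleftrightarrow> starts c k (map s [m..<Suc n])"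
proof (cases k)
  case (Suc k')
  show ?thesis
    using assms(1,2)
  proof (induction rule: inc_induct)
    case (step i)
    then have "[i..<Suc n] = i # [Suc i..<Suc n]" using assms(3) by (intro upt_conv_Cons) simp
    then show ?case using step Suc by simp
  qed simp
qed simp

text \<open>If \<open>s i = c\<close>, then the right-hand side is \<open>rise_vectors.run n s i k\<close>.\<close>

lemma starts_iff_blocks:
  assumes "i \<le> Suc n" "i \<le> n \<Longrightarrow> s i \<le> c"
  shows "starts c k (map s [i..<Suc n]) \<longleftrightarrow>
    (\<forall>t<k. (nxt n s ^^ t) i \<le> n \<and> s ((nxt n s ^^ t) i) = c)"
  using assms
proof (induction k arbitrary: i)
  case (Suc k)
  have split: "(\<forall>t<Suc k. Q t) \<longleftrightarrow> Q 0 \<and> (\<forall>t<k. Q (Suc t))" for Q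
    by (metis less_Suc_eq_0_disj)
  show ?case
  proof (cases "i \<le> n \<and> s i = c")
    case False
    then have "\<not> starts c (Suc k) (map s [i..<Suc n])"
      using Suc.prems upt_conv_Cons[of i "Suc n"] by (cases "i \<le> n") (auto simp del: upt_Suc)
    then show ?thesis using False by (auto simp: split)
  next
    case True
    let ?m = "nxt n s i"
    have m: "i < ?m" "?m \<le> Suc n" "?m \<le> n \<Longrightarrow> s ?m \<le> c"
      using nxt_gt[of i n s] nxt_le[of i n s] nxt_end[of n s i] True by auto
    have "[i..<Suc n] = i # [Suc i..<Suc n]" using True by (intro upt_conv_Cons) simp
    then have "starts c (Suc k) (map s [i..<Suc n]) \<longleftrightarrow> starts c k (map s [Suc i..<Suc n])"
      using True by simp
    also have "\<dots> \<longleftrightarrow> starts c k (map s [?m..<Suc n])"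
      using m True nxt_inside(2)[of i _ n s] by (intro starts_skip) auto
    also have "\<dots> \<longleftrightarrow> (\<forall>t<k. (nxt n s ^^ t) ?m \<le> n \<and> s ((nxt n s ^^ t) ?m) = c)"
      using Suc.IH[of ?m] m by simp
    finally show ?thesis using True by (simp add: split funpow_swap1)
  qed
qed simp

lemma not_starts_below: "(\<And>x xs. ys = x # xs \<Longrightarrow> x < c) \<Longrightarrow> \<not> starts c (Suc k) ys"
  by (cases ys) auto

section \<open>Counting words with a marked sequence of excursions\<close>

text \<open>Binomial coefficients that vanish for negative lower index, which makes Pascal's rule hold
  throughout.\<close>

definition ch :: "nat \<Rightarrow> int \<Rightarrow> int" where
  "ch a b = (if b < 0 then 0 else int (a choose nat b))"

lemma ch_Suc: "ch (Suc a) b = ch a b + ch a (b - 1)"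
proof (cases "b \<le> 0")
  case True
  then show ?thesis by (auto simp: ch_def)
next
  case False
  then have "nat b = Suc (nat (b - 1))" by simp
  then show ?thesis using False by (simp add: ch_def)
qed

text \<open>The number of words from height \<open>h\<close> to height \<open>0\<close> with \<open>N\<close> up steps, see \<open>card_words\<close>.\<close>

definition ballot :: "nat \<Rightarrow> nat \<Rightarrow> int" where
  "ballot h N = ch (2 * N + h) (int N) - ch (2 * N + h) (int N - 1)"

lemma ballot_0: "ballot h 0 = 1"
  by (simp add: ballot_def ch_def)

lemma ballot_Suc_Suc: "ballot (Suc h) (Suc N) = ballot h (Suc N) + ballot (Suc (Suc h)) N"
proof -
  have "ch (Suc (2 * Suc N + h)) b = ch (2 * Suc N + h) b + ch (2 * Suc N + h) (b - 1)" for b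
    by (rule ch_Suc)
  then show ?thesis by (simp add: ballot_def)
qed

lemma ch_symmetric: "ch (Suc (2 * N)) (1 + int N) = ch (Suc (2 * N)) (int N)"
proof -
  have "nat (1 + int N) = Suc N" by simp
  then show ?thesis
    using binomial_symmetric[of N "Suc (2 * N)"] by (simp add: ch_def)
qed

lemma ballot_0_Suc: "ballot 0 (Suc N) = ballot 1 N"
  using ch_symmetric[of N] ch_Suc[of "Suc (2 * N)"] by (simp add: ballot_def)

definition words :: "nat \<Rightarrow> nat \<Rightarrow> step list set" where
  "words h N = {W. path_from h W \<and> ups W = N}"

lemma words_split:
  "words h N = (if h = 0 \<and> N = 0 then {[]} else {})
     \<union> (if h = 0 then {} else (#) D ` words (h - 1) N)
     \<union> (if N = 0 then {} else (#) U ` words (Suc h) (N - 1))"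
proof (rule set_eqI)
  fix W
  show "W \<in> words h N \<longleftrightarrow> W \<in> (if h = 0 \<and> N = 0 then {[]} else {})
     \<union> (if h = 0 then {} else (#) D ` words (h - 1) N)
     \<union> (if N = 0 then {} else (#) U ` words (Suc h) (N - 1))"
    by (cases W; cases "hd W") (auto simp: words_def image_iff)
qed

lemma card_two_images:
  assumes "finite A" "finite B"
  shows "card ((#) D ` A \<union> (#) U ` B) = card A + card B"
proof -
  have "card ((#) D ` A \<union> (#) U ` B) = card ((#) D ` A) + card ((#) U ` B)"
    using assms by (intro card_Un_disjoint) auto
  then show ?thesis by (simp add: card_image)
qed

lemma finite_words: "finite (words h N)"
proof (induction "2 * N + h" arbitrary: h N rule: less_induct)
  case less
  then show ?case unfolding words_split[of h N] by auto
qed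

text \<open>The words from height \<open>h\<close> with \<open>N\<close> up steps such that \<open>k\<close> successive excursions follow the first
  moment at which the value has decreased by \<open>j\<close>.\<close>

definition run_words :: "(nat \<Rightarrow> int) \<Rightarrow> nat \<Rightarrow> int \<Rightarrow> nat \<Rightarrow> nat \<Rightarrow> nat \<Rightarrow> nat \<Rightarrow> step list set" where
  "run_words \<delta> i c h N j k = {W \<in> words h N. starts (c - int j) k (heights \<delta> i c W)}"

lemma card_words: "int (card (words h N)) = ballot h N"
proof (induction "2 * N + h" arbitrary: h N rule: less_induct)
  case less
  consider "h = 0" "N = 0" | h' where "h = Suc h'" "N = 0" | N' where "h = 0" "N = Suc N'"
    | h' N' where "h = Suc h'" "N = Suc N'"
    by (meson not0_implies_Suc)
  then show ?case
  proof cases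
    case 1
    then show ?thesis by (simp add: words_split[of 0 0] ballot_0)
  next
    case 2
    then show ?thesis using less[of 0 h'] by (simp add: words_split[of "Suc h'" 0] ballot_0 card_image)
  next
    case 3
    then show ?thesis using less[of N' 1]
      by (simp add: words_split[of 0 "Suc N'"] ballot_0_Suc card_image)
  next
    case 4
    then show ?thesis using less[of "Suc N'" h'] less[of N' "Suc h"]
      by (simp add: words_split[of "Suc h'" "Suc N'"] ballot_Suc_Suc card_two_images finite_words)
  qed
qed

lemma run_words_0: "run_words \<delta> i c h N j 0 = words h N"
  by (simp add: run_words_def)

lemma run_words_Suc_0:
  "run_words \<delta> i c h N 0 (Suc k) =
    (if N = 0 then {} else (#) U ` run_words \<delta> (Suc i) (c + \<delta> i) (Suc h) (N - 1) (nat (\<delta> i)) k)"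
  if "0 \<le> \<delta> i"
proof -
  have no: "\<not> starts c (Suc k) (heights \<delta> i (c - 1) W)" for W
    using hd_heights[of \<delta> i "c - 1" W] by (intro not_starts_below) force
  show ?thesis
  proof (rule set_eqI)
    fix W
    show "W \<in> run_words \<delta> i c h N 0 (Suc k) \<longleftrightarrow> W \<in> (if N = 0 then {} else
      (#) U ` run_words \<delta> (Suc i) (c + \<delta> i) (Suc h) (N - 1) (nat (\<delta> i)) k)"
      using no that by (cases W; cases "hd W") (auto simp: words_def run_words_def image_iff)
  qed
qed

lemma run_words_Suc_Suc:
  "run_words \<delta> i c (Suc h) N (Suc j) (Suc k) = (#) D ` run_words \<delta> i (c - 1) h N j (Suc k) \<union>
    (if N = 0 then {} else (#) U `
       run_words \<delta> (Suc i) (c + \<delta> i) (Suc (Suc h)) (N - 1) (Suc j + nat (\<delta> i)) (Suc k))"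
  if "0 \<le> \<delta> i"
proof (rule set_eqI)
  fix W
  show "W \<in> run_words \<delta> i c (Suc h) N (Suc j) (Suc k) \<longleftrightarrow>
    W \<in> (#) D ` run_words \<delta> i (c - 1) h N j (Suc k) \<union>
    (if N = 0 then {} else (#) U `
       run_words \<delta> (Suc i) (c + \<delta> i) (Suc (Suc h)) (N - 1) (Suc j + nat (\<delta> i)) (Suc k))"
    using that by (cases W; cases "hd W") (auto simp: words_def run_words_def image_iff algebra_simps)
qed

lemma finite_run_words: "finite (run_words \<delta> i c h N j k)"
  using finite_words[of h N] by (simp add: run_words_def)

text \<open>Induction over the first letter. If \<open>j = 0\<close>, it must be the up step that starts the first
  excursion; when \<open>\<delta> i = 1\<close>, the other \<open>k - 1\<close> excursions start after the value has dropped by \<open>1\<close>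
  again. The bound on \<open>\<delta>\<close> preserves \<open>j \<le> h\<close>, because of which the count does not depend on \<open>j\<close>.\<close>

lemma card_run_words:
  assumes \<delta>: "\<And>i. 0 \<le> \<delta> i" "\<And>i. \<delta> i \<le> 1"
  shows "j \<le> h \<Longrightarrow> int (card (run_words \<delta> i c h N j k)) = (if k \<le> N then ballot (h + k) (N - k) else 0)"
proof (induction "2 * N + h" arbitrary: h N i c j k rule: less_induct)
  case less
  have \<delta>1: "nat (\<delta> i) \<le> 1" for i using \<delta>(2)[of i] by simp
  show ?case
  proof (cases k)
    case 0
    then show ?thesis by (simp add: run_words_0 card_words)
  next
    case (Suc k')
    show ?thesis
    proof (cases j)
      case 0
      then show ?thesis using Suc less(1)[of "N - 1" "Suc h" "nat (\<delta> i)" "Suc i" "c + \<delta> i" k'] \<delta>1[of i]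
        by (cases N) (simp_all add: run_words_Suc_0 \<delta>(1) card_image)
    next
      case (Suc j')
      then obtain h' where h: "h = Suc h'" using less.prems by (cases h) auto
      have 1: "int (card (run_words \<delta> i (c - 1) h' N j' k)) =
          (if k \<le> N then ballot (h' + k) (N - k) else 0)"
        using less.hyps[of N h' j' i "c - 1" k] less.prems h Suc by simp
      show ?thesis
      proof (cases N)
        case 0
        then show ?thesis using 1 h Suc \<open>k = Suc k'\<close>
          by (simp add: run_words_Suc_Suc \<delta>(1) card_image)
      next
        case (Suc N')
        have 2: "int (card (run_words \<delta> (Suc i) (c + \<delta> i) (Suc h) N' (j + nat (\<delta> i)) k)) =
          (if k \<le> N' then ballot (Suc h + k) (N' - k) else 0)"
          using less.hyps[of N' "Suc h" "j + nat (\<delta> i)" "Suc i" "c + \<delta> i" k] less.prems \<delta>1[of i] Suc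
          by simp
        have "int (card (run_words \<delta> i c h N j k)) =
          int (card (run_words \<delta> i (c - 1) h' N j' k)) +
          int (card (run_words \<delta> (Suc i) (c + \<delta> i) (Suc h) N' (j + nat (\<delta> i)) k))"
          using run_words_Suc_Suc[of \<delta> i c h' N j' k'] \<delta>(1) h Suc \<open>j = Suc j'\<close> \<open>k = Suc k'\<close>
          by (simp add: card_two_images finite_run_words)
        also have "\<dots> = (if k \<le> N then ballot (h + k) (N - k) else 0)"
          unfolding 1 2 using h Suc ballot_Suc_Suc[of "h' + k" "N' - k"] ballot_0
          by (auto simp: Suc_diff_le not_less_eq_eq le_Suc_eq)
        finally show ?thesis .
      qed
    qed
  qed
qed

text \<open>The words from height \<open>h\<close> with \<open>N\<close> up steps that have a marked down step followed by \<open>k\<close>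
  successive excursions; \<open>A\<close> is the part before and \<open>W\<close> the part after the marked step.\<close>

definition marked :: "(nat \<Rightarrow> int) \<Rightarrow> nat \<Rightarrow> int \<Rightarrow> nat \<Rightarrow> nat \<Rightarrow> nat \<Rightarrow> (step list \<times> step list) set" where
  "marked \<delta> i c h N k = {(A, W). A @ D # W \<in> words h N \<and>
     starts (c + val \<delta> i A - 1) k (heights \<delta> (i + ups A) (c + val \<delta> i A - 1) W)}"

lemma marked_Nil:
  "([], W) \<in> marked \<delta> i c h N k \<longleftrightarrow> 0 < h \<and> W \<in> run_words \<delta> i (c - 1) (h - 1) N 0 k"
  by (auto simp: marked_def words_def run_words_def)

lemma marked_D:
  "(D # A, W) \<in> marked \<delta> i c h N k \<longleftrightarrow> 0 < h \<and> (A, W) \<in> marked \<delta> i (c - 1) (h - 1) N k"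
  by (auto simp: marked_def words_def algebra_simps)

lemma marked_U:
  "(U # A, W) \<in> marked \<delta> i c h N k \<longleftrightarrow>
     0 < N \<and> (A, W) \<in> marked \<delta> (Suc i) (c + \<delta> i) (Suc h) (N - 1) k"
  by (auto simp: marked_def words_def algebra_simps)

abbreviation cons_fst :: "'a \<Rightarrow> 'a list \<times> 'b \<Rightarrow> 'a list \<times> 'b" where
  "cons_fst x \<equiv> map_prod ((#) x) id"

lemma marked_split:
  "marked \<delta> i c h N k =
     (if h = 0 then {} else Pair [] ` run_words \<delta> i (c - 1) (h - 1) N 0 k
        \<union> cons_fst D ` marked \<delta> i (c - 1) (h - 1) N k)
     \<union> (if N = 0 then {} else cons_fst U ` marked \<delta> (Suc i) (c + \<delta> i) (Suc h) (N - 1) k)"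
  (is "_ = ?R")
proof (rule set_eqI, clarify)
  fix A W
  show "(A, W) \<in> marked \<delta> i c h N k \<longleftrightarrow> (A, W) \<in> ?R"
    by (cases A; cases "hd A") (auto simp: marked_Nil marked_D marked_U image_iff map_prod_def split: prod.splits)
qed

lemma finite_marked: "finite (marked \<delta> i c h N k)"
proof (induction "2 * N + h" arbitrary: i c h N rule: less_induct)
  case less
  then show ?case unfolding marked_split[of \<delta> i c h N k] by (auto simp: finite_run_words)
qed

lemma card_cons_fst: "card (cons_fst x ` M) = card M"
  by (rule card_image) (auto simp: inj_on_def)

text \<open>The number of elements of \<open>marked\<close>, see \<open>card_marked\<close>. For \<open>h = 0\<close>, Pascal's rule
  turns it into \<open>2 N - k\<close> choose \<open>N - k - 1\<close>.\<close>

definition marked_count :: "nat \<Rightarrow> nat \<Rightarrow> nat \<Rightarrow> int" where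
  "marked_count h N k = (if k \<le> N then ch (2 * N + h + 1 - k) (int N - int k) +
     (int h - 1) * ch (2 * N + h - k) (int N - int k) else 0)"

lemma marked_count_0:
  assumes "0 < k" "0 < N" shows "marked_count 0 N k = marked_count 1 (N - 1) k"
proof (cases "k \<le> N")
  case True
  have "2 * N + 1 - k = Suc (2 * N - k)" using True assms by simp
  then have "marked_count 0 N k = ch (2 * N - k) (int N - int k - 1)"
    using True by (simp add: marked_count_def ch_Suc)
  moreover have "marked_count 1 (N - 1) k = ch (2 * N - k) (int N - int k - 1)"
  proof (cases "k \<le> N - 1")
    case True
    then have "2 * (N - 1) + 1 + 1 - k = 2 * N - k" using assms by simp
    then show ?thesis using True assms by (simp add: marked_count_def algebra_simps of_nat_diff)
  next
    case False
    then show ?thesis using True by (simp add: marked_count_def ch_def)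
  qed
  ultimately show ?thesis by simp
qed (auto simp: marked_count_def)

lemma marked_count_Suc:
  assumes "0 < k"
  shows "marked_count (Suc h) N k = (if k \<le> N then ballot (h + k) (N - k) else 0) + marked_count h N k +
    (if N = 0 then 0 else marked_count (Suc (Suc h)) (N - 1) k)"
proof (cases "k \<le> N")
  case True
  define y where "y = N - k"
  define x where "x = 2 * y + h + k"
  have N: "N = y + k" using True by (simp add: y_def)
  have 1: "marked_count (Suc h) N k = ch (Suc (Suc x)) (int y) + int h * ch (Suc x) (int y)"
    by (simp add: marked_count_def N x_def algebra_simps)
  have 2: "marked_count h N k = ch (Suc x) (int y) + (int h - 1) * ch x (int y)"
    by (simp add: marked_count_def N x_def algebra_simps)
  have 3: "marked_count (Suc (Suc h)) (N - 1) k = ch (Suc x) (int y - 1) + (int h + 1) * ch x (int y - 1)"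
  proof (cases y)
    case 0
    then show ?thesis using assms by (simp add: marked_count_def N ch_def)
  next
    case (Suc y')
    then have "2 * (N - 1) + Suc (Suc h) + 1 - k = Suc x" "2 * (N - 1) + Suc (Suc h) - k = x"
      "int (N - 1) - int k = int y - 1" "k \<le> N - 1"
      by (simp_all add: N x_def)
    then show ?thesis by (simp add: marked_count_def)
  qed
  have 4: "ballot (h + k) (N - k) = ch x (int y) - ch x (int y - 1)"
    by (simp add: ballot_def N x_def algebra_simps)
  have "N \<noteq> 0" using assms True by simp
  then have "(if N = 0 then 0 else marked_count (Suc (Suc h)) (N - 1) k) =
    ch (Suc x) (int y - 1) + (int h + 1) * ch x (int y - 1)" using 3 by simp
  then show ?thesis using True
    by (simp add: 1 2 4 ch_Suc[of "Suc x" "int y"] ch_Suc[of x "int y"] algebra_simps)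
qed (auto simp: marked_count_def)

lemma card_marked:
  assumes \<delta>: "\<And>i. 0 \<le> \<delta> i" "\<And>i. \<delta> i \<le> 1" and "0 < k"
  shows "int (card (marked \<delta> i c h N k)) = marked_count h N k"
proof (induction "2 * N + h" arbitrary: i c h N rule: less_induct)
  case less
  let ?R = "run_words \<delta> i (c - 1) (h - 1) N 0 k"
  let ?M1 = "marked \<delta> i (c - 1) (h - 1) N k"
  let ?M2 = "marked \<delta> (Suc i) (c + \<delta> i) (Suc h) (N - 1) k"
  have U: "N \<noteq> 0 \<Longrightarrow> int (card ?M2) = marked_count (Suc h) (N - 1) k"
    using less[of "N - 1" "Suc h"] by simp
  show ?case
  proof (cases h)
    case 0
    show ?thesis
    proof (cases "N = 0")
      case True
      then have "marked \<delta> i c h N k = {}" using 0 by (subst marked_split) simp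
      then show ?thesis using True \<open>0 < k\<close> by (simp add: marked_count_def)
    next
      case False
      then have "marked \<delta> i c h N k = cons_fst U ` ?M2" using 0 by (subst marked_split) simp
      then show ?thesis using False 0 U marked_count_0[of k N] \<open>0 < k\<close> by (simp add: card_cons_fst)
    qed
  next
    case (Suc h')
    have R: "int (card (Pair ([] :: step list) ` ?R)) = (if k \<le> N then ballot (h' + k) (N - k) else 0)"
      using card_run_words[of \<delta>, OF \<delta>, of 0 h' i "c - 1" N k] Suc by (simp add: card_image inj_on_def)
    have M1: "int (card ?M1) = marked_count h' N k" using less[of N h'] Suc by simp
    have fin: "finite ?R" "finite ?M1" "finite ?M2" by (simp_all add: finite_run_words finite_marked)
    have "card (marked \<delta> i c h N k) =
      card (Pair ([] :: step list) ` ?R) + card (cons_fst D ` ?M1) +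
      (if N = 0 then 0 else card (cons_fst U ` ?M2))"
    proof (cases "N = 0")
      case True
      then have *: "marked \<delta> i c h N k = Pair [] ` ?R \<union> cons_fst D ` ?M1"
        using Suc by (subst marked_split) simp
      show ?thesis
        unfolding * using fin True by (subst card_Un_disjoint) auto
    next
      case False
      then have *: "marked \<delta> i c h N k = (Pair [] ` ?R \<union> cons_fst D ` ?M1) \<union> cons_fst U ` ?M2"
        using Suc by (subst marked_split) simp
      have "card (marked \<delta> i c h N k) = card (Pair ([] :: step list) ` ?R \<union> cons_fst D ` ?M1) + card (cons_fst U ` ?M2)"
        unfolding * using fin by (intro card_Un_disjoint) auto
      also have "card (Pair ([] :: step list) ` ?R \<union> cons_fst D ` ?M1) =
        card (Pair ([] :: step list) ` ?R) + card (cons_fst D ` ?M1)"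
        using fin by (intro card_Un_disjoint) auto
      finally show ?thesis using False by (simp only: if_False)
    qed
    then have "int (card (marked \<delta> i c h N k)) = (if k \<le> N then ballot (h' + k) (N - k) else 0)
      + marked_count h' N k + (if N = 0 then 0 else marked_count (Suc h) (N - 1) k)"
      using R M1 U by (simp add: card_cons_fst)
    then show ?thesis using marked_count_Suc[OF \<open>0 < k\<close>, of h' N] Suc by simp
  qed
qed

lemma card_marked_dyck:
  assumes "\<And>i. 0 \<le> \<delta> i" "\<And>i. \<delta> i \<le> 1" "0 < k"
  shows "card (marked \<delta> i c 0 n k) = binom (2 * int n - int k) (int n - int k - 1)"
proof -
  have "int (card (marked \<delta> i c 0 n k)) = marked_count 0 n k"
    using card_marked assms by blast
  also have "\<dots> = int (binom (2 * int n - int k) (int n - int k - 1))"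
  proof (cases "k \<le> n")
    case True
    then have "2 * n + 1 - k = Suc (2 * n - k)" by simp
    then have "marked_count 0 n k = ch (2 * n - k) (int n - int k - 1)"
      using True by (simp add: marked_count_def ch_Suc)
    moreover have "nat (2 * int n - int k) = 2 * n - k" using True by simp
    ultimately show ?thesis using True by (auto simp: ch_def binom_def)
  qed (simp add: marked_count_def binom_def)
  finally show ?thesis by simp
qed

lemma starts_heights_U:
  assumes "starts c k (heights \<delta> i c W)" "0 < k" shows "\<exists>W'. W = U # W'"
proof -
  obtain k' where k: "k = Suc k'" using assms(2) gr0_implies_Suc by blast
  show ?thesis
  proof (cases W)
    case Nil
    then show ?thesis using assms by (simp add: k)
  next
    case (Cons x V)
    have "\<not> starts c (Suc k') (heights \<delta> i (c - 1) V)"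
      using hd_heights[of \<delta> i "c - 1" V] by (intro not_starts_below) force
    then show ?thesis using assms Cons by (cases x) (auto simp: k)
  qed
qed

text \<open>For \<open>\<delta> = 0\<close>, each excursion is a single up step.\<close>

lemma starts_zero_iff:
  "starts 0 k (heights (\<lambda>_. 0) i 0 W) \<longleftrightarrow> (\<exists>V. W = replicate k U @ V)"
proof (induction k arbitrary: i W)
  case (Suc k)
  show ?case
  proof (cases "\<exists>W'. W = U # W'")
    case True
    then show ?thesis using Suc by auto
  next
    case False
    then have "\<not> starts 0 (Suc k) (heights (\<lambda>_. 0) i 0 W)"
      using starts_heights_U by blast
    then show ?thesis using False by auto
  qed
qed simp

text \<open>Reversal of a Dyck path.\<close>

definition mirror :: "step list \<Rightarrow> step list" where
  "mirror P = rev (map (\<lambda>x. if x = U then D else U) P)"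

lemma mirror_simps [simp]:
  "mirror [] = []" "mirror (A @ B) = mirror B @ mirror A" "mirror (x # A) = mirror A @ [if x = U then D else U]"
  "mirror (mirror P) = P"
proof -
  show "mirror (mirror P) = P"
    by (induction P) (use step.exhaust in \<open>auto simp: mirror_def\<close>)
qed (auto simp: mirror_def)

lemma mirror_replicate [simp]: "mirror (replicate k x) = replicate k (if x = U then D else U)"
  by (simp add: mirror_def)

lemma count_mirror [simp]: "count_list (mirror P) U = count_list P D" "count_list (mirror P) D = count_list P U"
  by (induction P) (auto, (metis step.exhaust)+)

lemma mirror_dyck: "P \<in> dyck_paths n \<Longrightarrow> mirror P \<in> dyck_paths n"
proof -
  assume P: "P \<in> dyck_paths n"
  have "count_list (take m (mirror P)) D \<le> count_list (take m (mirror P)) U" for m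
  proof -
    let ?l = "length P - m"
    have take: "take m (mirror P) = mirror (drop ?l P)"
      by (simp add: mirror_def take_rev drop_map)
    have "count_list (take ?l P @ drop ?l P) x = count_list (take ?l P) x + count_list (drop ?l P) x" for x
      by (rule count_list_append)
    then have *: "count_list (take ?l P) x + count_list (drop ?l P) x = n" for x
      using P by (cases x) (auto simp: dyck_paths_def)
    have "count_list (take ?l P) D \<le> count_list (take ?l P) U"
      using P by (simp add: dyck_paths_def)
    then show ?thesis unfolding take count_mirror using *[of U] *[of D] by linarith
  qed
  then show "mirror P \<in> dyck_paths n" using P by (simp add: dyck_paths_def)
qed

text \<open>Reversal maps the down steps and the up step in the factor \<open>d\<^sup>k u\<close> to \<open>d u\<^sup>k\<close>, and
  the paths with the latter factor are counted by \<open>marked\<close> for \<open>\<delta> = 0\<close>.\<close>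

lemma card_marked_descents:
  assumes "0 < k"
  shows "card {(A, W). A @ replicate k D @ U # W \<in> dyck_paths n} =
    binom (2 * int n - int k) (int n - int k - 1)"
proof -
  let ?L = "{(A, W). A @ replicate k D @ U # W \<in> dyck_paths n}"
  let ?f = "\<lambda>(A, W). (mirror W, replicate k U @ mirror A)"
  have shift: "starts c k (heights (\<lambda>_. 0) i c W) \<longleftrightarrow> starts 0 k (heights (\<lambda>_. 0) i 0 W)" for c i W
  proof -
    have "starts (0 + c) k (map (\<lambda>x. x + c) xs) \<longleftrightarrow> starts 0 k xs" for xs
      by (induction "0 :: int" k xs rule: starts.induct) auto
    then show ?thesis using heights_shift[of "\<lambda>_. 0" i 0 c W] by simp
  qed
  have M: "(A, W) \<in> marked (\<lambda>_. 0) 1 0 0 n k \<longleftrightarrow>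
      A @ D # W \<in> dyck_paths n \<and> (\<exists>V. W = replicate k U @ V)" for A W
    using shift[of "0 + val (\<lambda>_. 0) 1 A - 1" "1 + ups A" W]
      starts_zero_iff[of k "1 + ups A" W]
    by (simp add: marked_def words_def dyck_paths_eq)
  have "marked (\<lambda>_. 0) 1 0 0 n k = ?f ` ?L"
  proof (intro set_eqI iffI)
    fix z assume "z \<in> marked (\<lambda>_. 0) 1 0 0 n k"
    then obtain A V where z: "z = (A, replicate k U @ V)" "A @ D # replicate k U @ V \<in> dyck_paths n"
      using M[of "fst z" "snd z"] by (metis prod.collapse)
    then have "(mirror V, mirror A) \<in> ?L" using mirror_dyck[OF z(2)] by simp
    moreover have "z = ?f (mirror V, mirror A)" using z by simp
    ultimately show "z \<in> ?f ` ?L" by blast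
  next
    fix z assume "z \<in> ?f ` ?L"
    then obtain A W where z: "z = (mirror W, replicate k U @ mirror A)"
      "A @ replicate k D @ U # W \<in> dyck_paths n" by auto
    then show "z \<in> marked (\<lambda>_. 0) 1 0 0 n k"
      using mirror_dyck[OF z(2)] M[of "mirror W" "replicate k U @ mirror A"] by simp
  qed
  moreover have "inj_on ?f ?L"
  proof (rule inj_onI)
    fix x y assume "?f x = ?f y"
    then have "mirror (snd x) = mirror (snd y) \<and> mirror (fst x) = mirror (fst y)"
      by (simp add: case_prod_unfold)
    then show "x = y" by (metis mirror_simps(4) prod.expand)
  qed
  ultimately show ?thesis
    using card_marked_dyck[of "\<lambda>_. 0" k 1 0 n] assms card_image[of ?f ?L] by simp
qed

section \<open>Counting the linear intervals\<close>

lemma map_vec: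
  assumes "A @ W \<in> dyck_paths n"
  shows "map (vec \<delta> (A @ W)) [Suc (ups A)..<Suc n] = heights \<delta> (Suc (ups A)) (val \<delta> 1 A) W"
proof (rule nth_equalityI)
  have n: "n = ups A + ups W" using assms by (simp add: dyck_paths_eq)
  then show "length (map (vec \<delta> (A @ W)) [Suc (ups A)..<Suc n]) =
      length (heights \<delta> (Suc (ups A)) (val \<delta> 1 A) W)"
    by (simp del: upt_Suc)
  fix l assume "l < length (map (vec \<delta> (A @ W)) [Suc (ups A)..<Suc n])"
  then have l: "l < ups W" "l < length [Suc (ups A)..<Suc n]" using n by (simp_all del: upt_Suc)
  have "[Suc (ups A)..<Suc n] ! l = Suc (ups A) + l"
    using l n by (intro nth_upt) simp
  then have "map (vec \<delta> (A @ W)) [Suc (ups A)..<Suc n] ! l = vec \<delta> (A @ W) (Suc (ups A) + l)"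
    using l(2) by (simp only: nth_map)
  also have "\<dots> = heights \<delta> (Suc (ups A)) (val \<delta> 1 A) W ! l"
    using l(1) by (simp add: vec_def heights_append nth_append)
  finally show "map (vec \<delta> (A @ W)) [Suc (ups A)..<Suc n] ! l =
      heights \<delta> (Suc (ups A)) (val \<delta> 1 A) W ! l" .
qed

lemma finite_dyck_paths: "finite (dyck_paths n)"
  using finite_words[of 0 n] by (simp add: words_def dyck_paths_eq)

context
  fixes n :: nat and \<delta> :: "nat \<Rightarrow> int"
  assumes \<delta>: "\<And>i. 0 \<le> \<delta> i" "\<And>i. \<delta> i \<le> 1"
begin

interpretation rise_vectors n \<delta> "vec \<delta> ` dyck_paths n"
  using rise_vectors_dyck[of \<delta>] \<delta> by blast

lemma card_left:
  assumes "0 < k" shows "card (left_pairs k) = binom (2 * int n - int k) (int n - int k - 1)"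
proof -
  let ?L = "{(A, W). A @ replicate k D @ U # W \<in> dyck_paths n}"
  let ?f = "\<lambda>(A, W). (vec \<delta> (A @ replicate k D @ U # W), Suc (ups A))"
  have iff: "db k (vec \<delta> (A @ U # W)) (Suc (ups A)) \<longleftrightarrow> (\<exists>A'. A = A' @ replicate k D)"
    if "A @ U # W \<in> dyck_paths n" for A W
    using drop_before_iff[OF that] assms by (metis Suc_leI One_nat_def)
  have "{(s, j). s \<in> vec \<delta> ` dyck_paths n \<and> db k s j} = ?f ` ?L"
  proof (intro set_eqI iffI)
    fix z assume "z \<in> {(s, j). s \<in> vec \<delta> ` dyck_paths n \<and> db k s j}"
    then obtain P j where z: "z = (vec \<delta> P, j)" "P \<in> dyck_paths n" "db k (vec \<delta> P) j" by auto
    then have "j - 1 < ups P" "1 < j" by (auto simp: dyck_paths_eq drop_before_def)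
    with ex_up obtain A0 W where A0: "P = A0 @ U # W" "Suc (ups A0) = j"
      by (metis Suc_diff_1 less_trans zero_less_one)
    then obtain A where A: "A0 = A @ replicate k D" using iff z by blast
    then have "z = ?f (A, W)" "(A, W) \<in> ?L" using z A0 by auto
    then show "z \<in> ?f ` ?L" by blast
  next
    fix z assume "z \<in> ?f ` ?L"
    then obtain A W where z: "z = (vec \<delta> ((A @ replicate k D) @ U # W), Suc (ups (A @ replicate k D)))"
      "(A @ replicate k D) @ U # W \<in> dyck_paths n" by auto
    then show "z \<in> {(s, j). s \<in> vec \<delta> ` dyck_paths n \<and> db k s j}"
      using iff[OF z(2)] by blast
  qed
  moreover have "inj_on ?f ?L"
  proof (rule inj_onI, clarify)
    fix A W A' W'
    assume *: "A @ replicate k D @ U # W \<in> dyck_paths n" "A' @ replicate k D @ U # W' \<in> dyck_paths n"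
      "vec \<delta> (A @ replicate k D @ U # W) = vec \<delta> (A' @ replicate k D @ U # W')" "ups A = ups A'"
    then have "(A @ replicate k D) @ U # W = (A' @ replicate k D) @ U # W'"
      using inj_onD[OF inj_vec] by simp
    from up_unique[OF this] show "A = A' \<and> W = W'" using *(4) by simp
  qed
  ultimately show ?thesis
    using card_marked_descents[OF assms, of n] card_left_pairs[OF assms] by (simp add: card_image)
qed

lemma card_right:
  assumes "0 < k" shows "card (right_pairs k) = binom (2 * int n - int k) (int n - int k - 1)"
proof -
  let ?M = "marked \<delta> 1 0 0 n k"
  let ?f = "\<lambda>(A, W). (vec \<delta> (A @ D # W), Suc (ups A))"
  let ?S = "{(s, j). s \<in> vec \<delta> ` dyck_paths n \<and> db 1 s j \<and> run s j k}"
  have M: "(A, W) \<in> ?M \<longleftrightarrow> A @ D # W \<in> dyck_paths n \<and>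
      starts (val \<delta> 1 A - 1) k (heights \<delta> (Suc (ups A)) (val \<delta> 1 A - 1) W)" for A W
    by (simp add: marked_def words_def dyck_paths_eq)
  have M_U: "\<exists>W'. W = U # W'" if "(A, W) \<in> ?M" for A W
    using that starts_heights_U assms unfolding M by blast
  have db: "db 1 (vec \<delta> ((A @ [D]) @ U # W)) (Suc (ups A))"
    if "(A @ [D]) @ U # W \<in> dyck_paths n" for A W
    using drop_before_iff[OF that, of 1 \<delta>] by simp
  have run: "run (vec \<delta> (A @ D # U # W)) (Suc (ups A)) k \<longleftrightarrow> (A, U # W) \<in> ?M"
    if P: "A @ D # U # W \<in> dyck_paths n" for A W
  proof -
    let ?s = "vec \<delta> (A @ D # U # W)"
    have s: "?s (Suc (ups A)) = val \<delta> 1 A - 1"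
      using vec_at[of \<delta> "A @ [D]" W] by (simp add: val_append)
    have "Suc (ups A) \<le> Suc n" using P by (simp add: dyck_paths_eq)
    then have "run ?s (Suc (ups A)) k \<longleftrightarrow> starts (val \<delta> 1 A - 1) k (map ?s [Suc (ups A)..<Suc n])"
      unfolding run_def s by (intro starts_iff_blocks[symmetric]) (auto simp: s)
    also have "map ?s [Suc (ups A)..<Suc n] = heights \<delta> (Suc (ups A)) (val \<delta> 1 A - 1) (U # W)"
      using map_vec[of "A @ [D]" "U # W" n \<delta>] P by (simp add: val_append del: upt_Suc)
    finally show ?thesis unfolding M using P by blast
  qed
  have "?S = ?f ` ?M"
  proof (intro set_eqI iffI)
    fix z assume "z \<in> ?S"
    then obtain P j where z: "z = (vec \<delta> P, j)" "P \<in> dyck_paths n" "db 1 (vec \<delta> P) j"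
      "run (vec \<delta> P) j k" by blast
    then have "j - 1 < ups P" "1 < j" by (auto simp: dyck_paths_eq drop_before_def)
    with ex_up obtain A0 W where A0: "P = A0 @ U # W" "Suc (ups A0) = j"
      by (metis Suc_diff_1 less_trans zero_less_one)
    then obtain A where A: "A0 = A @ [D]" using drop_before_iff[of A0 W n 1 \<delta>] z by auto
    then have "(A, U # W) \<in> ?M" using run[of A W] z A0 by simp
    moreover have "z = ?f (A, U # W)" using z A0 A by simp
    ultimately show "z \<in> ?f ` ?M" by blast
  next
    fix z assume "z \<in> ?f ` ?M"
    then obtain p where "z = ?f p" "p \<in> ?M" by blast
    then obtain A W0 where z: "z = ?f (A, W0)" "(A, W0) \<in> ?M" by (cases p) blast
    then obtain W where W: "W0 = U # W" using M_U by blast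
    have P: "A @ D # U # W \<in> dyck_paths n" using z W M by simp
    show "z \<in> ?S" using run[OF P] db[of A W] P z W by simp
  qed
  moreover have "inj_on ?f ?M"
  proof (rule inj_onI, clarify)
    fix A W0 A' W0'
    assume *: "(A, W0) \<in> ?M" "(A', W0') \<in> ?M" "vec \<delta> (A @ D # W0) = vec \<delta> (A' @ D # W0')"
      "ups A = ups A'"
    then obtain W W' where W: "W0 = U # W" "W0' = U # W'" using M_U by meson
    have "(A @ [D]) @ U # W = (A' @ [D]) @ U # W'"
      using inj_onD[OF inj_vec[of \<delta> n] *(3)] *(1,2) W M by simp
    from up_unique[OF this] show "A = A' \<and> W0 = W0'" using *(4) W by simp
  qed
  ultimately show ?thesis
    using card_marked_dyck[of \<delta> k 1 0 n] card_right_pairs[OF assms] assms \<delta> by (simp add: card_image)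
qed

lemma finite_left_right: "finite (left_pairs k)" "finite (right_pairs k)"
proof -
  have "linear_pairs order k \<subseteq> (vec \<delta> ` dyck_paths n) \<times> (vec \<delta> ` dyck_paths n)"
    by (auto simp: linear_pairs_def order_def)
  then have "finite (linear_pairs order k)"
    by (rule finite_subset) (simp add: finite_dyck_paths)
  then show "finite (left_pairs k)" "finite (right_pairs k)"
    using finite_subset[OF left_pairs_linear] finite_subset[OF right_pairs_linear] by auto
qed

lemma card_linear_intervals_normalized:
  "card (linear_intervals (alt_tamari n \<delta>) 0) = card (dyck_paths n)"
  "card (linear_intervals (alt_tamari n \<delta>) 1) = binom (2 * int n - 1) (int n - 2)"
  "2 \<le> k \<Longrightarrow> card (linear_intervals (alt_tamari n \<delta>) k) =
     2 * binom (2 * int n - int k) (int n - int k - 1)"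
proof -
  note card = card_linear_intervals_alt_tamari[of \<delta> n, OF \<delta>]
  show "card (linear_intervals (alt_tamari n \<delta>) 0) = card (dyck_paths n)"
    unfolding card linear_pairs_order_0 using inj_vec[of \<delta> n]
    by (simp add: card_image inj_on_def)
  show "card (linear_intervals (alt_tamari n \<delta>) 1) = binom (2 * int n - 1) (int n - 2)"
    unfolding card using linear_pairs_order[of 1] left_pairs_1 card_left[of 1] by simp
  assume k: "2 \<le> k"
  have "card (linear_pairs order k) = card (left_pairs k) + card (right_pairs k)"
    using linear_pairs_order[of k] k left_right_disjoint[OF k] finite_left_right[of k]
    by (simp add: card_Un_disjoint)
  then show "card (linear_intervals (alt_tamari n \<delta>) k) =
     2 * binom (2 * int n - int k) (int n - int k - 1)"
    unfolding card using card_left[of k] card_right[of k] k by simp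
qed

end

lemma val_cong: "(\<And>l. i \<le> l \<Longrightarrow> l < i + ups W \<Longrightarrow> \<delta> l = \<delta>' l) \<Longrightarrow> val \<delta> i W = val \<delta>' i W"
  by (induction \<delta> i W rule: val.induct) auto

text \<open>The order only depends on the values of \<open>\<delta>\<close> at \<open>1, \<dots>, n\<close>.\<close>

lemma alt_tamari_cong:
  assumes "\<And>l. 1 \<le> l \<Longrightarrow> l \<le> n \<Longrightarrow> \<delta> l = \<delta>' l"
  shows "alt_tamari n \<delta> = alt_tamari n \<delta>'"
proof -
  have "is_excursion \<delta> (A @ [D] @ C @ B) (Suc (length A)) (length C) \<longleftrightarrow>
    is_excursion \<delta>' (A @ [D] @ C @ B) (Suc (length A)) (length C)"
    if "A @ [D] @ C @ B \<in> dyck_paths n" for A B C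
  proof -
    have n: "n = ups A + ups C + ups B" using that by (simp add: dyck_paths_eq)
    have "val \<delta> (Suc (ups A)) (take m C) = val \<delta>' (Suc (ups A)) (take m C)" for m
    proof (rule val_cong)
      fix l assume l: "Suc (ups A) \<le> l" "l < Suc (ups A) + ups (take m C)"
      have "ups (take m C) + ups (drop m C) = ups C"
        by (metis append_take_drop_id ups_append)
      then show "\<delta> l = \<delta>' l" using l n assms[of l] by simp
    qed
    from this this[of "length C"] have "excursion \<delta> (Suc (ups A)) C \<longleftrightarrow> excursion \<delta>' (Suc (ups A)) C"
      unfolding excursion_def by simp
    then show ?thesis
      using is_excursion_iff[of \<delta> "A @ [D]" C B] is_excursion_iff[of \<delta>' "A @ [D]" C B] by simp
  qed
  then have "(P, Q) \<in> rotation \<delta> \<longleftrightarrow> (P, Q) \<in> rotation \<delta>'" if "P \<in> dyck_paths n" for P Q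
    using that unfolding rotation_def mem_Collect_eq prod.inject by metis
  then have "Restr (rotation \<delta>) (dyck_paths n) = Restr (rotation \<delta>') (dyck_paths n)"
    by auto
  then show ?thesis by (simp add: alt_tamari_def)
qed

lemma card_dyck_paths: "real (card (dyck_paths n)) = 1 / (real n + 1) * real (2 * n choose n)"
proof -
  have "dyck_paths n = words 0 n" by (simp add: words_def dyck_paths_eq)
  then have *: "int (card (dyck_paths n)) = ballot 0 n" by (simp add: card_words)
  show ?thesis
  proof (cases n)
    case 0
    then show ?thesis using * by (simp add: ballot_0)
  next
    case (Suc m)
    have "Suc m * (2 * n choose Suc m) = (2 * n - m) * (2 * n choose m)"
      by (rule trans[OF binomial_absorption binomial_absorb_comp[symmetric]])
    moreover have "2 * n - m = n + 1" using Suc by simp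
    ultimately have "n * (2 * n choose n) = (n + 1) * (2 * n choose m)"
      unfolding Suc by (simp only:)
    then have "real (n * (2 * n choose n)) = real ((n + 1) * (2 * n choose m))"
      by (simp only:)
    then have "real n * real (2 * n choose n) = (real n + 1) * real (2 * n choose m)"
      by (simp only: of_nat_mult of_nat_add of_nat_1)
    moreover have "int (card (dyck_paths n)) = int (2 * n choose n) - int (2 * n choose m)"
    proof -
      have "1 \<le> n" "nat (int n - 1) = m" using Suc by simp_all
      then show ?thesis unfolding * ballot_def ch_def by simp
    qed
    then have "real (card (dyck_paths n)) = real (2 * n choose n) - real (2 * n choose m)"
      by linarith
    ultimately have "(real n + 1) * real (card (dyck_paths n)) = real (2 * n choose n)"
      by (simp only: right_diff_distrib) (simp add: distrib_right)
    then show ?thesis by (simp add: field_simps)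
  qed
qed

theorem theorem0p1:
  fixes n :: nat and \<delta> :: "nat \<Rightarrow> int"
  assumes "n \<ge> 1" and "\<delta> \<in> {1..n} \<rightarrow> {0, 1}"
  shows "real (card (linear_intervals (alt_tamari n \<delta>) 0)) =
           1 / (real n + 1) * real (binom (2 * int n) (int n))
       \<and> card (linear_intervals (alt_tamari n \<delta>) 1) = binom (2 * int n - 1) (int n - 2)
       \<and> (\<forall>k. 2 \<le> k \<and> k < n \<longrightarrow>
            card (linear_intervals (alt_tamari n \<delta>) k) =
              2 * binom (2 * int n - int k) (int n - int k - 1))
       \<and> (\<forall>k\<ge>n. linear_intervals (alt_tamari n \<delta>) k = {})"
proof -
  define \<delta>' where "\<delta>' l = (if 1 \<le> l \<and> l \<le> n then \<delta> l else 0)" for l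
  have "\<delta> l \<in> {0, 1}" if "1 \<le> l" "l \<le> n" for l using assms(2) that by auto
  then have 01: "0 \<le> \<delta>' l" "\<delta>' l \<le> 1" for l unfolding \<delta>'_def by force+
  have eq: "alt_tamari n \<delta> = alt_tamari n \<delta>'"
    by (rule alt_tamari_cong) (simp add: \<delta>'_def)
  note card = card_linear_intervals_normalized[where \<delta> = \<delta>' and n = n, OF 01, folded eq]
  have "linear_intervals (alt_tamari n \<delta>) k = {}" if "n \<le> k" for k
  proof -
    have "card (linear_intervals (alt_tamari n \<delta>) k) = 0"
    proof (cases "2 \<le> k")
      case True
      then show ?thesis using card(3)[of k] that by (simp add: binom_def)
    next
      case False
      then have "k = 1" "n = 1" using that assms(1) by auto
      then show ?thesis using card(2) by (simp add: binom_def)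
    qed
    moreover have "linear_intervals (alt_tamari n \<delta>) k \<subseteq> Pow (dyck_paths n)"
      by (auto simp: linear_intervals_def interval_def alt_tamari_def)
    then have "finite (linear_intervals (alt_tamari n \<delta>) k)"
      by (rule finite_subset) (simp add: finite_dyck_paths)
    ultimately show ?thesis by simp
  qed
  moreover have "binom (2 * int n) (int n) = 2 * n choose n"
    by (simp add: binom_def nat_mult_distrib)
  ultimately show ?thesis using card card_dyck_paths[of n] by simp
qed

end
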